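(* Let $S$ be a finitely generated free abelian semigroup. Then for $\lambda=\pm1$, $\mathrm{MS}_{\mathbb{Z},\lambda}(S)$ is a polynomial algebra $\mathbb{Z}[Y]$, where $Y=\coprod_{n\ge1}Y^{(n)}$ is a graded set whose homogeneous component $Y^{(n)}$ has cardinality $|\mathrm{Lyn}(S)^{(n)}|$ for every $n\ge1$. Here $\mathrm{Lyn}(S)^{(n)}$ is the set of Lyndon words on $S$ of degree $n$.
   Context: Mixable shuffle algebra: for a commutative ring $\mathbf{k}$, $\lambda\in\mathbf{k}$ and an abelian semigroup $S$, $\mathrm{MS}_{\mathbf{k},\lambda}(S)$ is the free $\mathbf{k}$-module on the words $M^{\otimes}(S)=\{1\}\cup\{u_1\otimes\cdots\otimes u_r\mid u_i\in S,\ r\ge1\}$ with the bilinear product $\diamond$ with identity $1$ and $(a\otimes\mathfrak{a}')\diamond(b\otimes\mathfrak{b}')=a\otimes(\mathfrak{a}'\diamond(b\otimes\mathfrak{b}'))+b\otimes((a\otimes\mathfrak{a}')\diamond\mathfrak{b}')+\lambda\,(ab)\otimes(\mathfrak{a}'\diamond\mathfrak{b}')$ for letters $a,b\in S$ and (possibly empty) words $\mathfrak{a}',\mathfrak{b}'$ (with $a\otimes1$ read as $a$). Free abelian semigroups have no identity element. With $S$ free on a finite ordered set $\{x_1,\dots,x_k\}$, $\deg(x_1^{n_1}\cdots x_k^{n_k})=\sum n_i$, and $S$ is totally ordered first by degree, then, for equal degree, lexicographically as induced by the order on the generators. The degree of a word is $\deg(w_1\otimes\cdots\otimes w_r)=\sum\deg(w_i)$;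 this makes $\mathrm{MS}_{\mathbb{Z},\lambda}(S)$ a graded algebra. Lexicographic order on words: $u<v$ iff either $v=u\otimes x$ with $x$ non-empty, or $u=x\otimes a\otimes u'$, $v=x\otimes b\otimes v'$ with letters $a<b$. A Lyndon word is a non-empty word $w$ such that $w=u\otimes v$ with $u,v\ne1$ implies $w<v$. *)

theory Defs
  imports
    "HOL-Algebra.QuotRing"
    "HOL-Library.Multiset"
    "HOL-Library.Poly_Mapping"
    "HOL-Library.Disjoint_Sets"
    "HOL-Library.Equipollence"
begin

section \<open>Finitely generated free abelian semigroups\<close>

text \<open>
  The free abelian semigroup on the finite ordered set of all elements of \<open>'x\<close>, written
  multiplicatively: the monomial \<open>x\<^sub>1\<^bsup>n1\<^esup> \<dots> x\<^sub>k\<^bsup>nk\<^esup>\<close> is the multiset containing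
  each \<open>x\<^sub>i\<close> with multiplicity \<open>n\<^sub>i\<close>. The empty multiset is excluded, since the semigroup has
  no identity element.
\<close>

typedef 'x free_semigroup = "{m :: 'x multiset. m \<noteq> {#}}"
  morphisms mset_of Abs_free_semigroup
  by (rule exI[of _ "{#undefined#}"]) simp

setup_lifting type_definition_free_semigroup

instantiation free_semigroup :: (type) ab_semigroup_mult
begin

lift_definition times_free_semigroup ::
  "'x free_semigroup \<Rightarrow> 'x free_semigroup \<Rightarrow> 'x free_semigroup" is "(+)"
  by simp

instance
  by standard (transfer; simp add: ac_simps)+

end

lift_definition deg :: "'x free_semigroup \<Rightarrow> nat" is size .

text \<open>
  The nondecreasing sequence of generators of which a monomial is the product. Monomials of equal
  degree are compared lexicographically through it, e.g.
  \<open>x\<^sub>1x\<^sub>1 < x\<^sub>1x\<^sub>2 < x\<^sub>1x\<^sub>3 < x\<^sub>2x\<^sub>2\<close> for \<open>x\<^sub>1 < x\<^sub>2 < x\<^sub>3\<close>.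
\<close>

lift_definition generators :: "'x::linorder free_semigroup \<Rightarrow> 'x list"
  is sorted_list_of_multiset .

lemma generators_inject: "generators a = generators b \<longleftrightarrow> a = b"
  by transfer (metis mset_sorted_list_of_multiset)

abbreviation lex_less :: "('a::linorder list \<times> 'a list) set"
  where "lex_less \<equiv> lexord {(a, b). a < b}"

lemma lex_less_irrefl: "(u, u) \<notin> lex_less"
  by (simp add: lexord_irreflexive)

lemma lex_less_trans: "(u, v) \<in> lex_less \<Longrightarrow> (v, w) \<in> lex_less \<Longrightarrow> (u, w) \<in> lex_less"
  by (erule lexord_trans) (auto intro: transI)

lemma lex_less_linear: "(u, v) \<in> lex_less \<or> u = v \<or> (v, u) \<in> lex_less"
  by (rule lexord_linear) auto

instantiation free_semigroup :: (linorder) linorder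
begin

definition less_free_semigroup :: "'a free_semigroup \<Rightarrow> 'a free_semigroup \<Rightarrow> bool"
  where "a < b \<longleftrightarrow> deg a < deg b \<or> deg a = deg b \<and> (generators a, generators b) \<in> lex_less"

definition less_eq_free_semigroup :: "'a free_semigroup \<Rightarrow> 'a free_semigroup \<Rightarrow> bool"
  where "a \<le> b \<longleftrightarrow> a < b \<or> a = b" for a b :: "'a free_semigroup"

instance
proof
  fix a b c :: "'a free_semigroup"
  have irrefl: "\<not> a < a" for a :: "'a free_semigroup"
    by (simp add: less_free_semigroup_def lex_less_irrefl)
  have trans: "a < c" if "a < b" "b < c" for a b c :: "'a free_semigroup"
    using that lex_less_trans[of "generators a" "generators b" "generators c"]
    by (auto simp: less_free_semigroup_def)
  show "a < b \<longleftrightarrow> a \<le> b \<and> \<not> b \<le> a"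
    using irrefl[of a] trans[of a b a] by (auto simp: less_eq_free_semigroup_def)
  show "a \<le> a"
    by (simp add: less_eq_free_semigroup_def)
  show "a \<le> b \<Longrightarrow> b \<le> c \<Longrightarrow> a \<le> c"
    using trans[of a b c] by (auto simp: less_eq_free_semigroup_def)
  show "a \<le> b \<Longrightarrow> b \<le> a \<Longrightarrow> a = b"
    using irrefl[of a] trans[of a b a] by (auto simp: less_eq_free_semigroup_def)
  show "a \<le> b \<or> b \<le> a"
    using lex_less_linear[of "generators a" "generators b"]
    by (auto simp: less_eq_free_semigroup_def less_free_semigroup_def generators_inject)
qed

end

section \<open>Words\<close>

text \<open>Words are lists of letters; the empty list is the word \<open>1\<close>.\<close>

definition word_deg :: "'x free_semigroup list \<Rightarrow> nat"
  where "word_deg w = sum_list (map deg w)"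

definition lyndon :: "'s::linorder list \<Rightarrow> bool"
  where "lyndon w \<longleftrightarrow>
    w \<noteq> [] \<and> (\<forall>u v. w = u @ v \<and> u \<noteq> [] \<and> v \<noteq> [] \<longrightarrow> (w, v) \<in> lex_less)"

definition Lyn :: "nat \<Rightarrow> 'x::linorder free_semigroup list set"
  where "Lyn n = {w. lyndon w \<and> word_deg w = n}"

section \<open>The mixable shuffle algebra over the integers\<close>

text \<open>
  The free \<open>\<int>\<close>-module on the words is the type of finitely supported integer-valued functions on
  words, and \<^const>\<open>frag_extend\<close> is linear extension from the basis.
\<close>

definition prepend :: "'s \<Rightarrow> ('s list \<Rightarrow>\<^sub>0 int) \<Rightarrow> ('s list \<Rightarrow>\<^sub>0 int)"
  where "prepend a = frag_extend (\<lambda>w. frag_of (a # w))"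

fun mshuffle_words :: "int \<Rightarrow> 's::ab_semigroup_mult list \<Rightarrow> 's list \<Rightarrow> ('s list \<Rightarrow>\<^sub>0 int)" where
  "mshuffle_words lam [] v = frag_of v"
| "mshuffle_words lam (a # u) [] = frag_of (a # u)"
| "mshuffle_words lam (a # u) (b # v) =
     prepend a (mshuffle_words lam u (b # v))
     + prepend b (mshuffle_words lam (a # u) v)
     + frag_cmul lam (prepend (a * b) (mshuffle_words lam u v))"

definition mshuffle ::
  "int \<Rightarrow> ('s::ab_semigroup_mult list \<Rightarrow>\<^sub>0 int) \<Rightarrow> ('s list \<Rightarrow>\<^sub>0 int) \<Rightarrow> ('s list \<Rightarrow>\<^sub>0 int)"
  where "mshuffle lam f g = frag_extend (\<lambda>u. frag_extend (\<lambda>v. mshuffle_words lam u v) g) f"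

definition MS :: "int \<Rightarrow> ('s::ab_semigroup_mult list \<Rightarrow>\<^sub>0 int) ring"
  where "MS lam = \<lparr>carrier = UNIV, monoid.mult = mshuffle lam, one = frag_of [], zero = 0, add = (+)\<rparr>"

definition homogeneous :: "nat \<Rightarrow> ('x free_semigroup list \<Rightarrow>\<^sub>0 int) set"
  where "homogeneous n = {f. \<forall>w \<in> Poly_Mapping.keys f. word_deg w = n}"

section \<open>Polynomial algebras over the integers\<close>

text \<open>
  \<open>\<int>[Y]\<close> consists of the finitely supported integer-valued functions on those monomials
  \<open>m :: 'y \<Rightarrow>\<^sub>0 nat\<close> (finitely supported exponent functions) that involve only variables
  in \<open>Y\<close>; its multiplication is the convolution product of \<^theory>\<open>HOL-Library.Poly_Mapping\<close>.
\<close>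

definition poly_algebra :: "'y set \<Rightarrow> (('y \<Rightarrow>\<^sub>0 nat) \<Rightarrow>\<^sub>0 int) ring"
  where "poly_algebra Y =
    \<lparr>carrier = {p. \<forall>m \<in> Poly_Mapping.keys p. Poly_Mapping.keys m \<subseteq> Y},
     monoid.mult = (*), one = 1, zero = 0, add = (+)\<rparr>"

definition poly_var :: "'y \<Rightarrow> (('y \<Rightarrow>\<^sub>0 nat) \<Rightarrow>\<^sub>0 int)"
  where "poly_var y = Poly_Mapping.single (Poly_Mapping.single y 1) 1"

text \<open>
  \<open>R\<close> is the polynomial algebra \<open>\<int>[Y]\<close> on its subset \<open>Y\<close>: the variables \<open>y \<in> Y\<close> correspond to
  themselves under a ring isomorphism (which, being additive, is \<open>\<int>\<close>-linear).
\<close>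

definition is_polynomial_algebra_on :: "'y ring \<Rightarrow> 'y set \<Rightarrow> bool"
  where "is_polynomial_algebra_on R Y \<longleftrightarrow>
    Y \<subseteq> carrier R \<and> (\<exists>\<phi> \<in> ring_iso (poly_algebra Y) R. \<forall>y \<in> Y. \<phi> (poly_var y) = y)"

end

theory Submission
  imports Defs "HOL-Library.List_Lexorder" "HOL-Computational_Algebra.Formal_Power_Series"
begin

text \<open>
  For \<open>\<lambda> = 1\<close> a word \<open>w = a\<^sub>1 \<otimes> \<dots> \<otimes> a\<^sub>r\<close> can be read as the quasi-symmetric function
  \<open>\<Sum> a\<^sub>1(x\<^sub>i\<^sub>1) \<cdots> a\<^sub>r(x\<^sub>i\<^sub>r)\<close>, summed over \<open>i\<^sub>1 < \<dots> < i\<^sub>r\<close>, where every index \<open>i\<close> carries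
  its own copy \<open>x\<^sub>i\<close> of the generators: the mixable shuffle product is the product of such series.
  A word is thus a sum of monomials, and symmetric functions can be evaluated at these monomials.
  The \<open>n\<close>-th power sum gives the word \<open>w\<^sup>[\<^sup>n\<^sup>]\<close> whose letters are the \<open>n\<close>-th powers of those of \<open>w\<close>,
  and the \<open>n\<close>-th elementary symmetric function gives an element \<open>e\<^sub>n(w)\<close>
  with integer coefficients. The polynomial generators are the \<open>e\<^sub>j(v)\<close> with \<open>j \<ge> 1\<close> and \<open>v\<close> a Lyndon
  word that is not of the form \<open>u\<^sup>[\<^sup>g\<^sup>]\<close> with \<open>g \<ge> 2\<close>. Since \<open>(v, j) \<mapsto> v\<^sup>[\<^sup>j\<^sup>]\<close> is a bijection from these pairs
  to all Lyndon words and \<open>e\<^sub>j(v)\<close> is homogeneous of the degree of \<open>v\<^sup>[\<^sup>j\<^sup>]\<close>, their numbers in each degree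
  are as claimed. For a single generator of the semigroup these are Hazewinkel's polynomial generators of
  the ring of quasi-symmetric functions over the integers.

  They generate the algebra for two reasons. Compare words of the same degree first by length and then
  lexicographically. For Lyndon words \<open>v\<^sub>1 > v\<^sub>2 > \<dots>\<close> the leading word of
  \<open>e\<^sub>r\<^sub>1(v\<^sub>1) \<cdot> e\<^sub>r\<^sub>2(v\<^sub>2) \<cdot> \<dots>\<close> is \<open>v\<^sub>1 \<dots> v\<^sub>1 v\<^sub>2 \<dots> v\<^sub>2 \<dots>\<close>, each \<open>v\<^sub>i\<close> repeated \<open>r\<^sub>i\<close> times, with
  coefficient 1 (\<open>leads_prod_esym\<close>). Every word is a nonincreasing product of Lyndon words, so
  these products span (\<open>Lyndon_esym_generate\<close>). Further, if \<open>v = u\<^sup>[\<^sup>g\<^sup>]\<close>, then \<open>e\<^sub>n(v)\<close> is the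
  \<open>n\<close>-th elementary symmetric function of \<open>g\<close>-th powers, hence an integer polynomial in the
  \<open>e\<^sub>j(u)\<close> (\<open>esym_word_power_in_subring\<close>).

  Algebraic independence then follows by counting. A nonincreasing factorization into Lyndon words is
  unique, so there are at most as many monomials of degree at most \<open>N\<close> in the generators as there are
  words of degree at most \<open>N\<close>, and a surjective homomorphism from a free \<open>\<int>\<close>-module to one of at least
  the same finite rank is injective (\<open>surjective_imp_injective\<close>).

  The case \<open>\<lambda> = -1\<close> reduces to \<open>\<lambda> = 1\<close> by multiplying every word \<open>w\<close> by \<open>(-1)\<^bsup>length w\<^esup>\<close>: merging two
  letters shortens a word by one (\<open>sign_twist_mshuffle\<close>).
\<close>

section \<open>Lyndon words and the lexicographic order\<close>

lemma append_less_append_iff [simp]: "p @ u < p @ v \<longleftrightarrow> u < v" for p :: "'s::linorder list"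
  by (induction p) auto

lemma less_append [simp]: "u < u @ x \<longleftrightarrow> x \<noteq> []" for u :: "'s::linorder list"
  using append_less_append_iff[of u "[]" x] by (cases x) auto

text \<open>
  Words \<open>u < v\<close> differ at some position of both unless \<open>u\<close> is a prefix of \<open>v\<close>, and a
  difference inside both words survives appending anything.
\<close>

lemma append_mono_less:
  fixes u v :: "'s::linorder list"
  assumes "u < v" and "\<And>x. v \<noteq> u @ x"
  shows "u @ s < v @ t"
  using assms
proof (induction u arbitrary: v)
  case Nil
  then show ?case using Nil(2)[of v] by simp
next
  case (Cons a u)
  then show ?case by (cases v) auto
qed

lemma append_mono_less_length:
  fixes u v :: "'s::linorder list"
  assumes "u < v" and "length v \<le> length u"
  shows "u @ s < v @ t"
proof (rule append_mono_less[OF assms(1)])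
  fix x show "v \<noteq> u @ x" using assms by (cases x) auto
qed

lemma lyndon_iff:
  "lyndon w \<longleftrightarrow> w \<noteq> [] \<and> (\<forall>u v. w = u @ v \<longrightarrow> u \<noteq> [] \<longrightarrow> v \<noteq> [] \<longrightarrow> w < v)"
  unfolding lyndon_def list_less_def by blast

lemma lyndon_nonempty: "lyndon w \<Longrightarrow> w \<noteq> []"
  by (simp add: lyndon_def)

lemma lyndon_less_suffix: "lyndon (u @ v) \<Longrightarrow> u \<noteq> [] \<Longrightarrow> v \<noteq> [] \<Longrightarrow> u @ v < v"
  by (simp add: lyndon_iff)

lemma lyndon_single: "lyndon [a]"
  by (auto simp: lyndon_iff append_eq_Cons_conv Cons_eq_append_conv)

text \<open>
  If \<open>s\<close> is not a prefix of \<open>m\<close>, then \<open>s \<le> l < m\<close> already decides. If \<open>m = s @ x\<close>, then \<open>m < x\<close> because \<open>x\<close> is a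
  proper suffix of the Lyndon word \<open>m\<close>, and the two words differ inside \<open>x\<close> since \<open>x\<close> is shorter.
\<close>

lemma prefix_lyndon_less:
  fixes m :: "'s::linorder list"
  assumes "lyndon m" "l < m" "l = s @ l'" "s \<noteq> []"
  shows "s @ m @ t < m @ t'"
proof (cases "\<exists>x. m = s @ x")
  case True
  then obtain x where x: "m = s @ x" by blast
  have "x \<noteq> []" using assms x by auto
  with assms x have "m < x" by (simp add: lyndon_less_suffix)
  then have "m @ t < x @ t'" by (rule append_mono_less_length) (simp add: x)
  then show ?thesis by (simp add: x)
next
  case False
  have "s \<le> l" using assms by (simp add: le_less)
  with assms have "s < m" by simp
  then show ?thesis using False by (intro append_mono_less) auto
qed

lemma lyndon_append:
  assumes "lyndon l" "lyndon m" "l < m"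
  shows "lyndon (l @ m)"
  unfolding lyndon_iff
proof (intro conjI allI impI)
  show "l @ m \<noteq> []" using assms lyndon_nonempty by auto
  have lm: "l @ m < m"
    using prefix_lyndon_less[of m l l "[]" "[]" "[]"] assms lyndon_nonempty by auto
  fix u v assume uv: "l @ m = u @ v" "u \<noteq> []" "v \<noteq> []"
  from uv(1) consider x where "l = u @ x" "v = x @ m" | x where "u = l @ x" "m = x @ v"
    by (auto simp: append_eq_append_conv2)
  then show "l @ m < v"
  proof cases
    case 1
    show ?thesis
    proof (cases "x = []")
      case True with 1 lm show ?thesis by simp
    next
      case False
      with 1 uv assms have "l < x" by (simp add: lyndon_less_suffix)
      then show ?thesis unfolding 1(2) by (rule append_mono_less_length) (simp add: 1)
    qed
  next
    case 2
    then have "m \<le> v" using lyndon_less_suffix[of x v] assms uv by (cases "x = []") auto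
    with lm show ?thesis by simp
  qed
qed

section \<open>Factorization into nonincreasing Lyndon words\<close>

text \<open>
  Products of Lyndon words are commutative, so factorizations are indexed by multisets; this is the
  word that a multiset of factors spells when sorted in nonincreasing order.
\<close>

definition decr_concat :: "'s::linorder list multiset \<Rightarrow> 's list"
  where "decr_concat A = concat (rev (sorted_list_of_multiset A))"

lemma decr_concat_empty [simp]: "decr_concat {#} = []"
  by (simp add: decr_concat_def)

lemma decr_concat_union:
  assumes "\<And>x y. x \<in># A \<Longrightarrow> y \<in># B \<Longrightarrow> y \<le> x"
  shows "decr_concat (A + B) = decr_concat A @ decr_concat B"
proof -
  have "sorted_list_of_multiset (A + B) = sorted_list_of_multiset B @ sorted_list_of_multiset A"
    (is "_ = ?l")
  proof -
    have "sorted ?l" using assms by (simp add: sorted_append)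
    then have "sort ?l = ?l" by (rule sorted_sort_id)
    moreover have "sorted_list_of_multiset (mset ?l) = sort ?l" by (rule sorted_list_of_multiset_mset)
    moreover have "mset ?l = A + B" by simp
    ultimately show ?thesis by metis
  qed
  then show ?thesis by (simp add: decr_concat_def)
qed

lemma decr_concat_single [simp]: "decr_concat {#l#} = l"
  by (simp add: decr_concat_def)

lemma decr_concat_add_max:
  assumes "\<And>y. y \<in># A \<Longrightarrow> y \<le> l"
  shows "decr_concat (add_mset l A) = l @ decr_concat A"
  using decr_concat_union[of "{#l#}" A] assms by simp

text \<open>
  Peeling off the largest element is peeling off the first factor of the nonincreasing concatenation.
\<close>

lemma multiset_max_induct [case_names empty add]:
  fixes A :: "'a::linorder multiset"
  assumes "P {#}"
    and "\<And>A l. P A \<Longrightarrow> (\<And>y. y \<in># A \<Longrightarrow> y \<le> l) \<Longrightarrow> P (add_mset l A)"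
  shows "P A"
proof (induction "size A" arbitrary: A)
  case 0
  then show ?case using assms(1) by simp
next
  case (Suc n)
  then have "A \<noteq> {#}" by auto
  then have m: "Max (set_mset A) \<in># A" by simp
  define B where "B = A - {#Max (set_mset A)#}"
  have A: "A = add_mset (Max (set_mset A)) B" using m by (simp add: B_def)
  have "y \<le> Max (set_mset A)" if "y \<in># B" for y
    using that by (simp add: B_def in_diffD)
  moreover have "P B" using Suc A by (metis add_left_cancel size_add_mset plus_1_eq_Suc Suc_inject)
  ultimately show ?case using assms(2) A by metis
qed

lemma length_decr_concat: "length (decr_concat A) = (\<Sum>l\<in>#A. length l)"
  by (induction A rule: multiset_max_induct) (simp_all add: decr_concat_add_max)

lemma word_deg_append [simp]: "word_deg (u @ v) = word_deg u + word_deg v"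
  and word_deg_Nil [simp]: "word_deg [] = 0"
  and word_deg_Cons [simp]: "word_deg (a # u) = deg a + word_deg u"
  by (simp_all add: word_deg_def)

lemma word_deg_decr_concat: "word_deg (decr_concat A) = (\<Sum>l\<in>#A. word_deg l)"
  by (induction A rule: multiset_max_induct) (simp_all add: decr_concat_add_max)

definition all_lyndon :: "'s::linorder list multiset \<Rightarrow> bool"
  where "all_lyndon A \<longleftrightarrow> (\<forall>l\<in>#A. lyndon l)"

lemma all_lyndon_simps [simp]:
  "all_lyndon {#}"
  "all_lyndon (add_mset l A) \<longleftrightarrow> lyndon l \<and> all_lyndon A"
  "all_lyndon (A + B) \<longleftrightarrow> all_lyndon A \<and> all_lyndon B"
  by (auto simp: all_lyndon_def)

text \<open>
  A letter is a Lyndon word. Put in front of a nonincreasing sequence of Lyndon words, it is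
  merged with the first of them as long as that one is larger; \<open>lyndon_append\<close> keeps the result Lyndon.
\<close>

lemma Lyndon_factorization_exists: "\<exists>A. all_lyndon A \<and> decr_concat A = w"
proof -
  have cons: "\<exists>B. all_lyndon B \<and> decr_concat B = l @ decr_concat A"
    if "lyndon l" "all_lyndon A" for A :: "'a list multiset" and l
    using that
  proof (induction A arbitrary: l rule: multiset_max_induct)
    case empty
    then show ?case by (intro exI[of _ "{#l#}"]) simp
  next
    case (add A m)
    show ?case
    proof (cases "m \<le> l")
      case True
      with add.hyps have "y \<le> l" if "y \<in># add_mset m A" for y using that by fastforce
      then have "decr_concat (add_mset l (add_mset m A)) = l @ decr_concat (add_mset m A)"
        by (rule decr_concat_add_max)
      then show ?thesis using add.prems
        by (intro exI[of _ "add_mset l (add_mset m A)"]) simp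
    next
      case False
      then have "lyndon (l @ m)" using add.prems by (intro lyndon_append) auto
      then obtain B where "all_lyndon B" "decr_concat B = (l @ m) @ decr_concat A"
        using add by fastforce
      then show ?thesis using add.hyps by (intro exI[of _ B]) (simp add: decr_concat_add_max)
    qed
  qed
  show ?thesis
  proof (induction w)
    case Nil
    show ?case by (intro exI[of _ "{#}"]) simp
  next
    case (Cons a w)
    then show ?case using cons[OF lyndon_single[of a]] by fastforce
  qed
qed

text \<open>
  A prefix of the concatenation ends inside one of the factors, that is, with a prefix of a word
  that is at most \<open>l\<close>.
\<close>

lemma prefix_of_decr_concat_ends_low:
  assumes "\<And>y. y \<in># A \<Longrightarrow> y \<le> l" "decr_concat A = x @ r" "x \<noteq> []"
  shows "\<exists>y t. x = y @ t \<and> t \<noteq> [] \<and> t \<le> l"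
  using assms
proof (induction A arbitrary: x rule: multiset_max_induct)
  case empty
  then show ?case by simp
next
  case (add A k)
  then have eq: "k @ decr_concat A = x @ r" by (simp add: decr_concat_add_max)
  have k: "k \<le> l" using add by simp
  from eq consider z where "k = x @ z" | z where "x = k @ z" "decr_concat A = z @ r" "z \<noteq> []"
    by (metis append_Nil2 append_eq_append_conv2)
  then show ?case
  proof cases
    case 1
    then have "x \<le> k" by (simp add: le_less)
    with k have "x \<le> l" by simp
    with add.prems show ?thesis by (intro exI[of _ "[]"] exI[of _ x]) simp
  next
    case 2
    then obtain y t where "z = y @ t" "t \<noteq> []" "t \<le> l" using add.IH add.prems by fastforce
    with 2 show ?thesis by (intro exI[of _ "k @ y"] exI[of _ t]) simp
  qed
qed

text \<open>
  If the first factors were different, the longer one \<open>m\<close> would properly extend the shorter one \<open>l\<close> and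
  would end with a suffix \<open>t \<le> l \<le> m\<close>, although a Lyndon word is smaller than its proper suffixes.
\<close>

lemma Lyndon_factorization_unique:
  assumes "all_lyndon A" "all_lyndon B" "decr_concat A = decr_concat B"
  shows "A = B"
  using assms
proof (induction A arbitrary: B rule: multiset_max_induct)
  case empty
  show ?case
  proof (rule ccontr)
    assume "{#} \<noteq> B"
    then obtain l B' where "B = add_mset l B'" by (metis multiset_cases)
    with empty show False
      using lyndon_nonempty[of l] length_decr_concat[of B] by simp
  qed
next
  case (add A l)
  have step: "False"
    if eq: "l @ decr_concat A = m @ decr_concat B" and max: "\<And>y. y \<in># A \<Longrightarrow> y \<le> l"
      and less: "length l < length m" and lyn: "lyndon l" "lyndon m"
    for A B :: "'a list multiset" and l m
  proof -
    from eq less obtain x where x: "m = l @ x" "x \<noteq> []" "decr_concat A = x @ decr_concat B"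
      by (auto simp: append_eq_append_conv2)
    then obtain y t where t: "x = y @ t" "t \<noteq> []" "t \<le> l"
      using prefix_of_decr_concat_ends_low[OF max] by blast
    have "m < t" using lyn(2) lyndon_less_suffix[of "l @ y" t] lyndon_nonempty[OF lyn(1)] t x
      by simp
    moreover have "l \<le> m" by (simp add: x le_less)
    ultimately show False using t by simp
  qed
  have "B \<noteq> {#}"
    using add lyndon_nonempty[of l] by (auto simp: decr_concat_add_max)
  define m where "m = Max (set_mset B)"
  define B' where "B' = B - {#m#}"
  have B: "B = add_mset m B'" using \<open>B \<noteq> {#}\<close> by (simp add: B'_def m_def)
  have m: "y \<le> m" if "y \<in># B'" for y
    using that by (simp add: B'_def m_def in_diffD)
  have eq: "l @ decr_concat A = m @ decr_concat B'"
    using add B m by (simp add: decr_concat_add_max)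
  have "length l = length m"
    using step[OF eq add.hyps] step[OF eq[symmetric] m] add.prems B
    by (metis all_lyndon_simps(2) linorder_neqE_nat)
  with eq have "l = m" "decr_concat A = decr_concat B'" by auto
  with add.IH add.prems B show ?case by auto
qed

definition lyndon_factors :: "'s::linorder list \<Rightarrow> 's list multiset"
  where "lyndon_factors w = (SOME A. all_lyndon A \<and> decr_concat A = w)"

lemma all_lyndon_factors [simp]: "all_lyndon (lyndon_factors w)"
  and decr_concat_factors [simp]: "decr_concat (lyndon_factors w) = w"
  using someI_ex[OF Lyndon_factorization_exists[of w]] by (simp_all add: lyndon_factors_def)

text \<open>
  The smallest factor of \<open>q\<close> comes last, so it is a proper suffix of the Lyndon word \<open>a # q\<close>.
\<close>

lemma factors_of_lyndon_suffix:
  assumes "lyndon (a # q)" "y \<in># lyndon_factors q"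
  shows "a # q < y"
proof -
  define A m where "A = lyndon_factors q" and "m = Min (set_mset A)"
  have "A \<noteq> {#}" using assms by (auto simp: A_def)
  then have m: "m \<in># A" "\<And>z. z \<in># A \<Longrightarrow> m \<le> z" by (simp_all add: m_def)
  then have "A = (A - {#m#}) + {#m#}" by simp
  moreover have "decr_concat ((A - {#m#}) + {#m#}) = decr_concat (A - {#m#}) @ m"
    using m(2) by (subst decr_concat_union) (auto dest: in_diffD)
  ultimately have q: "q = decr_concat (A - {#m#}) @ m" by (metis A_def decr_concat_factors)
  have "lyndon m" using m(1) all_lyndon_factors[of q] by (auto simp: A_def all_lyndon_def)
  then have "m \<noteq> []" by (rule lyndon_nonempty)
  then have "a # q < m"
    using lyndon_less_suffix[of "a # decr_concat (A - {#m#})" m] assms(1) q by simp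
  also have "m \<le> y" using m(2) assms(2) by (simp add: A_def)
  finally show ?thesis .
qed

section \<open>Shuffles of a multiset of words\<close>

text \<open>
  The words obtained by interleaving all words of a multiset. They are generated letter by letter, each
  letter being taken from the front of one of the words, because the proofs below compare words from
  the left and do not care about the order of the factors.
\<close>

inductive shuffle_of :: "'s list multiset \<Rightarrow> 's list \<Rightarrow> bool" where
  empty: "shuffle_of {#} []"
| drop: "shuffle_of M z \<Longrightarrow> shuffle_of (add_mset [] M) z"
| step: "shuffle_of (add_mset x M) z \<Longrightarrow> shuffle_of (add_mset (a # x) M) (a # z)"

lemma shuffle_of_length: "shuffle_of M z \<Longrightarrow> length z = (\<Sum>l\<in>#M. length l)"
  by (induction rule: shuffle_of.induct) auto

lemma shuffle_of_single: "shuffle_of {#w#} w"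
  by (induction w) (auto intro: shuffle_of.intros)

lemma shuffle_of_Cons:
  assumes "shuffle_of M (a # z)"
  obtains x N where "M = add_mset (a # x) N" "shuffle_of (add_mset x N) z"
proof -
  have "\<exists>x N. M = add_mset (a # x) N \<and> shuffle_of (add_mset x N) z"
    using assms
  proof (induction M "a # z" rule: shuffle_of.induct)
    case (drop M)
    then obtain x N where "M = add_mset (a # x) N" "shuffle_of (add_mset x N) z" by blast
    then show ?case
      by (intro exI[of _ x] exI[of _ "add_mset [] N"])
        (auto simp: add_mset_commute[of _ "[]"] intro: shuffle_of.drop)
  qed blast
  then show thesis using that by blast
qed

text \<open>
  Cutting a word into two pieces allows more interleavings.
\<close>

lemma shuffle_of_split:
  "shuffle_of (add_mset (u @ v) M) z \<Longrightarrow> shuffle_of (add_mset u (add_mset v M)) z"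
proof (induction "add_mset (u @ v) M" z arbitrary: u v M rule: shuffle_of.induct)
  case (drop N z)
  show ?case
  proof (cases "u @ v = []")
    case True
    with drop show ?thesis by (auto intro: shuffle_of.drop)
  next
    case False
    with drop.hyps(3) obtain M' where M: "M = add_mset [] M'" "N = add_mset (u @ v) M'"
      by (auto simp: add_eq_conv_ex)
    then have "shuffle_of (add_mset [] (add_mset u (add_mset v M'))) z"
      using drop.hyps(2) by (intro shuffle_of.drop) auto
    then show ?thesis by (simp add: M add_mset_commute)
  qed
next
  case (step x N z a)
  from step.hyps(3) consider "a # x = u @ v" "N = M"
    | M' where "M = add_mset (a # x) M'" "N = add_mset (u @ v) M'"
    by (auto simp: add_eq_conv_ex)
  then show ?case
  proof cases
    case 1
    show ?thesis
    proof (cases u)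
      case Nil
      with 1 step.hyps(1) show ?thesis by (auto intro: shuffle_of.intros)
    next
      case (Cons b u')
      with 1 have "shuffle_of (add_mset u' (add_mset v M)) z" using step.hyps(2) by simp
      then show ?thesis using 1 Cons by (auto intro: shuffle_of.step)
    qed
  next
    case 2
    then have "shuffle_of (add_mset u (add_mset v (add_mset x M'))) z"
      using step.hyps(2) by (auto simp: add_mset_commute)
    then have "shuffle_of (add_mset x (add_mset u (add_mset v M'))) z"
      by (simp add: add_mset_commute)
    then have "shuffle_of (add_mset (a # x) (add_mset u (add_mset v M'))) (a # z)"
      by (rule shuffle_of.step)
    then show ?thesis by (simp add: 2 add_mset_commute)
  qed
qed simp

lemma shuffle_of_remove_Nil: "shuffle_of (add_mset [] M) z \<Longrightarrow> shuffle_of M z"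
proof (induction "add_mset [] M" z arbitrary: M rule: shuffle_of.induct)
  case (drop N z)
  then show ?case by simp
next
  case (step x N z a)
  then obtain M' where M: "M = add_mset (a # x) M'" "N = add_mset [] M'"
    by (auto simp: add_eq_conv_ex)
  then show ?case using step.hyps(2)[of "add_mset x M'"]
    by (auto simp: add_mset_commute intro: shuffle_of.step)
qed simp

lemma shuffle_of_split_list:
  "shuffle_of (add_mset (concat ls) M) z \<Longrightarrow> shuffle_of (mset ls + M) z"
proof (induction ls arbitrary: M)
  case Nil
  then show ?case by (simp add: shuffle_of_remove_Nil)
next
  case (Cons l ls)
  then have "shuffle_of (add_mset (concat ls) (add_mset l M)) z"
    using shuffle_of_split[of l "concat ls" M z] by (simp add: add_mset_commute)
  then show ?case using Cons.IH[of "add_mset l M"] by simp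
qed

lemma shuffle_of_split_factors:
  "shuffle_of (add_mset w M) z \<Longrightarrow> shuffle_of (lyndon_factors w + M) z"
  using shuffle_of_split_list[of "rev (sorted_list_of_multiset (lyndon_factors w))" M z]
  by (simp flip: decr_concat_def)

lemma shuffle_of_shuffles:
  "z \<in> shuffles u v \<Longrightarrow> shuffle_of A u \<Longrightarrow> shuffle_of B v \<Longrightarrow> shuffle_of (A + B) z"
proof (induction z arbitrary: u v A B)
  case Nil
  have nil: "shuffle_of (A + B) z" if "shuffle_of A []" "shuffle_of B z" for A B :: "'a list multiset" and z
    using that by (induction A "[] :: 'a list" rule: shuffle_of.induct) (auto intro: shuffle_of.intros)
  from Nil show ?case using nil by simp
next
  case (Cons c z)
  from Cons.prems(1) consider (l) u' where "u = c # u'" "z \<in> shuffles u' v"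
    | (r) v' where "v = c # v'" "z \<in> shuffles u v'"
    by (auto simp: Cons_in_shuffles_iff neq_Nil_conv)
  then show ?case
  proof cases
    case l
    from Cons.prems(2) l obtain x N where "A = add_mset (c # x) N" "shuffle_of (add_mset x N) u'"
      by (auto elim: shuffle_of_Cons)
    with Cons.IH[OF l(2) this(2) Cons.prems(3)] show ?thesis by (auto intro: shuffle_of.step)
  next
    case r
    from Cons.prems(3) r obtain x N where "B = add_mset (c # x) N" "shuffle_of (add_mset x N) v'"
      by (auto elim: shuffle_of_Cons)
    with Cons.IH[OF r(2) Cons.prems(2) this(2)] show ?thesis by (auto intro: shuffle_of.step)
  qed
qed

text \<open>
  Taking the first letter of \<open>a # q\<close> instead of that of the maximum \<open>k\<close> of \<open>N\<close> loses strictly. After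
  \<open>a\<close> the nonincreasing concatenation continues with the factors of \<open>q\<close> larger than \<open>k\<close> and then with \<open>k\<close>.
  So it starts with a nonempty prefix of \<open>a # q\<close> followed by \<open>k\<close>, to which \<open>prefix_lyndon_less\<close> applies.
\<close>

lemma Cons_decr_concat_less:
  assumes l: "lyndon (a # q)" and N: "all_lyndon N" and m: "m \<in># N" "a # q < m"
  shows "a # decr_concat (lyndon_factors q + N) < decr_concat (add_mset (a # q) N)"
proof -
  define k where "k = Max (set_mset N)"
  have "set_mset N \<noteq> {}" using m by auto
  then have k: "k \<in># N" "\<And>y. y \<in># N \<Longrightarrow> y \<le> k"
    unfolding k_def by (meson Max_in Max_ge finite_set_mset)+
  have lk: "a # q < k" using k(2)[OF m(1)] m(2) by simp
  define hi lo where "hi = filter_mset (\<lambda>f. f > k) (lyndon_factors q)"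
    and "lo = filter_mset (\<lambda>f. \<not> f > k) (lyndon_factors q)"
  have fq: "lyndon_factors q = hi + lo" by (simp add: hi_def lo_def multiset_partition[symmetric])
  have Nk: "N = add_mset k (N - {#k#})" using k by simp
  have "decr_concat (hi + lo) = decr_concat hi @ decr_concat lo"
    by (rule decr_concat_union) (auto simp: hi_def lo_def)
  then have q: "q = decr_concat hi @ decr_concat lo" by (metis fq decr_concat_factors)
  have e1: "decr_concat (lyndon_factors q + N)
    = decr_concat hi @ k @ decr_concat (lo + (N - {#k#}))"
  proof -
    have e: "lyndon_factors q + N = hi + add_mset k (lo + (N - {#k#}))"
      using Nk by (metis fq add.assoc union_mset_add_mset_right)
    have c1: "y \<le> x" if "x \<in># hi" "y \<in># add_mset k (lo + (N - {#k#}))" for x y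
    proof -
      have "k < x" using that(1) by (simp add: hi_def)
      moreover have "y \<le> k" using that(2) k(2) by (auto simp: lo_def dest: in_diffD)
      ultimately show ?thesis by simp
    qed
    have c2: "y \<le> k" if "y \<in># lo + (N - {#k#})" for y
      using that k(2) by (auto simp: lo_def dest: in_diffD)
    have "decr_concat (add_mset k (lo + (N - {#k#}))) = k @ decr_concat (lo + (N - {#k#}))"
      by (rule decr_concat_add_max) (rule c2)
    moreover have "decr_concat (hi + add_mset k (lo + (N - {#k#})))
      = decr_concat hi @ decr_concat (add_mset k (lo + (N - {#k#})))"
      by (rule decr_concat_union) (rule c1)
    ultimately show ?thesis by (simp only: e)
  qed
  have e2: "decr_concat (add_mset (a # q) N) = k @ decr_concat (add_mset (a # q) (N - {#k#}))"
  proof -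
    have "y \<le> k" if "y \<in># add_mset (a # q) (N - {#k#})" for y
      using that k(2) lk by (auto dest: in_diffD)
    then have "decr_concat (add_mset k (add_mset (a # q) (N - {#k#}))) = k @ decr_concat (add_mset (a # q) (N - {#k#}))"
      by (rule decr_concat_add_max)
    moreover have "add_mset k (add_mset (a # q) (N - {#k#})) = add_mset (a # q) N"
      using Nk by (metis add_mset_commute)
    ultimately show ?thesis by simp
  qed
  have "lyndon k" using N k by (simp add: all_lyndon_def)
  then have "(a # decr_concat hi) @ k @ decr_concat (lo + (N - {#k#}))
      < k @ decr_concat (add_mset (a # q) (N - {#k#}))"
    by (rule prefix_lyndon_less[OF _ lk, of _ "decr_concat lo"]) (simp_all flip: q)
  then show ?thesis unfolding e1 e2 append_Cons .
qed

text \<open>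
  If \<open>a # q\<close> is maximal, then the factors of \<open>q\<close>, being larger than \<open>a # q\<close>, are larger than
  everything in \<open>N\<close>, and the two sides are equal.
\<close>

lemma Cons_decr_concat_le:
  assumes l: "lyndon (a # q)" and N: "all_lyndon N"
  shows "a # decr_concat (lyndon_factors q + N) \<le> decr_concat (add_mset (a # q) N)"
proof (cases "\<exists>m. m \<in># N \<and> a # q < m")
  case True
  with Cons_decr_concat_less[OF l N] show ?thesis by (auto simp: le_less)
next
  case False
  then have le: "y \<le> a # q" if "y \<in># N" for y using that by force
  moreover have "y \<le> x" if "x \<in># lyndon_factors q" "y \<in># N" for x y
    using le[OF that(2)] factors_of_lyndon_suffix[OF l that(1)] by simp
  ultimately show ?thesis by (simp add: decr_concat_union decr_concat_add_max)
qed

text \<open>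
  The largest shuffle of Lyndon words is their nonincreasing concatenation. Removing the first letter \<open>a\<close>
  of a shuffle leaves a shuffle in which a Lyndon word \<open>a # q\<close> has been replaced by \<open>q\<close>, hence also a shuffle
  of the Lyndon factors of \<open>q\<close> with the other words, so that induction applies.
\<close>

lemma shuffle_of_lyndon_le:
  assumes "shuffle_of L z" "all_lyndon L"
  shows "z \<le> decr_concat L"
  using assms
proof (induction z arbitrary: L rule: list.induct)
  case Nil
  then show ?case by simp
next
  case (Cons a z)
  from Cons.prems(1) obtain q N where L: "L = add_mset (a # q) N" "shuffle_of (add_mset q N) z"
    by (rule shuffle_of_Cons)
  then have "z \<le> decr_concat (lyndon_factors q + N)"
    using Cons.prems by (intro Cons.IH shuffle_of_split_factors) auto
  then have "a # z \<le> a # decr_concat (lyndon_factors q + N)" by simp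
  also have "\<dots> \<le> decr_concat L"
    unfolding L(1) using Cons.prems L by (intro Cons_decr_concat_le) auto
  finally show ?case .
qed

text \<open>
  The maximal shuffle can only begin with the first letter of a largest word. This strict form is what
  makes leading coefficients equal to 1.
\<close>

lemma shuffle_of_lyndon_less:
  assumes "shuffle_of (add_mset q N) z" "lyndon (a # q)" "all_lyndon N" "m \<in># N" "a # q < m"
  shows "a # z < decr_concat (add_mset (a # q) N)"
proof -
  have "z \<le> decr_concat (lyndon_factors q + N)"
    using assms by (intro shuffle_of_lyndon_le shuffle_of_split_factors) auto
  then have "a # z \<le> a # decr_concat (lyndon_factors q + N)" by simp
  also have "\<dots> < decr_concat (add_mset (a # q) N)"
    using assms by (intro Cons_decr_concat_less)
  finally show ?thesis .
qed

section \<open>The mixable shuffle product\<close>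

lemma frag_of_Cons: "frag_of (a # w) = prepend a (frag_of w)"
  by (simp add: prepend_def)

lemma prepend_add: "prepend a (f + g) = prepend a f + prepend a g"
  and prepend_diff: "prepend a (f - g) = prepend a f - prepend a g"
  and prepend_cmul: "prepend a (frag_cmul c f) = frag_cmul c (prepend a f)"
  and prepend_zero [simp]: "prepend a 0 = 0"
  by (simp_all add: prepend_def frag_extend_add frag_extend_diff frag_extend_cmul)

lemma lookup_prepend:
  "Poly_Mapping.lookup (prepend a f) w =
    (case w of [] \<Rightarrow> 0 | b # u \<Rightarrow> if b = a then Poly_Mapping.lookup f u else 0)"
proof -
  have "Poly_Mapping.keys f \<subseteq> UNIV" by simp
  then show ?thesis
    by (induction f rule: frag_induction)
      (auto simp: prepend_diff lookup_minus split: list.splits simp flip: frag_of_Cons)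
qed

lemma keys_prepend: "Poly_Mapping.keys (prepend a f) = (#) a ` Poly_Mapping.keys f"
  by (auto simp: in_keys_iff lookup_prepend image_iff split: list.splits if_splits)

lemma mshuffle_diff_left: "mshuffle lam (f - g) h = mshuffle lam f h - mshuffle lam g h"
  and mshuffle_add_left: "mshuffle lam (f + g) h = mshuffle lam f h + mshuffle lam g h"
  and mshuffle_cmul_left: "mshuffle lam (frag_cmul c f) h = frag_cmul c (mshuffle lam f h)"
  and mshuffle_zero_left [simp]: "mshuffle lam 0 h = 0"
  by (simp_all add: mshuffle_def frag_extend_diff frag_extend_add frag_extend_cmul)

lemma mshuffle_words_Nil_right [simp]: "mshuffle_words lam u [] = frag_of u"
  by (cases u) auto

lemma mshuffle_words_commute: "mshuffle_words lam u v = mshuffle_words lam v u"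
  by (induction lam u v rule: mshuffle_words.induct) (auto simp: add_ac mult.commute)

lemma mshuffle_frag_of [simp]: "mshuffle lam (frag_of u) (frag_of v) = mshuffle_words lam u v"
  by (simp add: mshuffle_def)

lemma mshuffle_diff_right: "mshuffle lam f (g - h) = mshuffle lam f g - mshuffle lam f h"
proof -
  have "Poly_Mapping.keys f \<subseteq> UNIV" by simp
  then show ?thesis
  proof (induction f rule: frag_induction)
    case (one u)
    then show ?case by (simp add: mshuffle_def frag_extend_diff)
  qed (simp_all add: mshuffle_diff_left)
qed

lemma mshuffle_zero_right [simp]: "mshuffle lam f 0 = 0"
  using mshuffle_diff_right[of lam f 0 0] by simp

text \<open>
  Bilinear identities need only be checked on pairs of words.
\<close>

lemma mshuffle_induct:
  fixes P :: "('a list \<Rightarrow>\<^sub>0 int) \<Rightarrow> ('b list \<Rightarrow>\<^sub>0 int) \<Rightarrow> bool"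
  assumes "\<And>u v. P (frag_of u) (frag_of v)" "\<And>f. P f 0" "\<And>g. P 0 g"
    and "\<And>f g h. P f h \<Longrightarrow> P g h \<Longrightarrow> P (f - g) h"
    and "\<And>f g h. P f g \<Longrightarrow> P f h \<Longrightarrow> P f (g - h)"
  shows "P f g"
proof -
  have *: "Poly_Mapping.keys f \<subseteq> UNIV" "Poly_Mapping.keys g \<subseteq> UNIV" by simp_all
  have "P (frag_of u) g" for u
    using *(2) by (induction g rule: frag_induction) (auto intro: assms)
  with *(1) show ?thesis
    by (induction f rule: frag_induction) (auto intro: assms)
qed

lemma mshuffle_commute: "mshuffle lam f g = mshuffle lam g f"
  by (induction f g rule: mshuffle_induct)
    (simp_all add: mshuffle_diff_left mshuffle_diff_right mshuffle_words_commute)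

lemma mshuffle_add_right: "mshuffle lam f (g + h) = mshuffle lam f g + mshuffle lam f h"
  and mshuffle_cmul_right: "mshuffle lam f (frag_cmul c g) = frag_cmul c (mshuffle lam f g)"
  by (simp_all add: mshuffle_commute[of lam f] mshuffle_add_left mshuffle_cmul_left)

lemma mshuffle_one_left [simp]: "mshuffle lam (frag_of []) f = f"
proof -
  have "Poly_Mapping.keys f \<subseteq> UNIV" by simp
  then show ?thesis
    by (induction f rule: frag_induction) (simp_all add: mshuffle_diff_right)
qed

lemma mshuffle_one_right [simp]: "mshuffle lam f (frag_of []) = f"
  by (simp add: mshuffle_commute[of lam f])

lemma frag_cmul_diff_right: "frag_cmul c (a - b) = frag_cmul c a - frag_cmul c b"
  by (rule poly_mapping_eqI) (simp add: lookup_minus algebra_simps)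

lemma mshuffle_prepend:
  "mshuffle lam (prepend a f) (prepend b g) = prepend a (mshuffle lam f (prepend b g))
    + prepend b (mshuffle lam (prepend a f) g) + frag_cmul lam (prepend (a * b) (mshuffle lam f g))"
  by (induction f g rule: mshuffle_induct)
    (simp_all add: mshuffle_diff_left mshuffle_diff_right prepend_diff frag_cmul_diff_right
      flip: frag_of_Cons)

text \<open>
  For nonempty words with first letters \<open>a\<close>, \<open>b\<close>, \<open>c\<close> both sides expand into the same seven terms, one for each
  nonempty subset of \<open>{a, b, c}\<close> multiplied into the first letter; their remainders agree by induction.
\<close>

lemma mshuffle_assoc: "mshuffle lam (mshuffle lam f g) h = mshuffle lam f (mshuffle lam g h)"
proof -
  let ?m = "mshuffle lam"
  have words: "?m (?m (frag_of u) (frag_of v)) (frag_of w) = ?m (frag_of u) (?m (frag_of v) (frag_of w))"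
    for u v w :: "'a list"
  proof (induction "length u + length v + length w" arbitrary: u v w rule: less_induct)
    case less
    show ?case
    proof (cases "u = [] \<or> v = [] \<or> w = []")
      case True
      then show ?thesis
        by (elim disjE) (simp_all del: mshuffle_frag_of)
    next
      case False
      then obtain a u' b v' c w' where eq: "u = a # u'" "v = b # v'" "w = c # w'"
        by (auto simp: neq_Nil_conv)
      define U V W where "U = frag_of u'" and "V = frag_of v'" and "W = frag_of w'"
      define A B C where "A = prepend a U" and "B = prepend b V" and "C = prepend c W"
      have ABC: "frag_of u = A" "frag_of v = B" "frag_of w = C"
        by (simp_all add: eq A_def B_def C_def U_def V_def W_def frag_of_Cons del: mshuffle_frag_of)
      have IH: "?m (?m U B) C = ?m U (?m B C)" "?m (?m A V) C = ?m A (?m V C)"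
          "?m (?m A B) W = ?m A (?m B W)" "?m (?m U V) C = ?m U (?m V C)"
          "?m (?m U B) W = ?m U (?m B W)" "?m (?m A V) W = ?m A (?m V W)"
          "?m (?m U V) W = ?m U (?m V W)"
        unfolding U_def V_def W_def ABC[symmetric] by (rule less; simp add: eq)+
      have mAB: "?m A B = prepend a (?m U B) + prepend b (?m A V) + frag_cmul lam (prepend (a * b) (?m U V))"
        and mBC: "?m B C = prepend b (?m V C) + prepend c (?m B W) + frag_cmul lam (prepend (b * c) (?m V W))"
        unfolding A_def B_def C_def by (rule mshuffle_prepend)+
      have C': "?m (prepend x f) C = prepend x (?m f C) + prepend c (?m (prepend x f) W)
          + frag_cmul lam (prepend (x * c) (?m f W))" for x f
        unfolding C_def by (rule mshuffle_prepend)
      have A': "?m A (prepend x f) = prepend a (?m U (prepend x f)) + prepend x (?m A f)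
          + frag_cmul lam (prepend (a * x) (?m U f))" for x f
        unfolding A_def by (rule mshuffle_prepend)
      have "?m (?m A B) C = prepend a (?m (?m U B) C) + prepend b (?m (?m A V) C)
          + frag_cmul lam (prepend (a * b) (?m (?m U V) C)) + prepend c (?m (?m A B) W)
          + frag_cmul lam (prepend (a * c) (?m (?m U B) W)) + frag_cmul lam (prepend (b * c) (?m (?m A V) W))
          + frag_cmul lam (frag_cmul lam (prepend (a * b * c) (?m (?m U V) W)))"
        unfolding mAB
        by (simp only: mshuffle_add_left mshuffle_cmul_left C' prepend_add prepend_cmul
            frag_cmul_distrib2 mult.assoc) (simp only: add_ac)
      also have "\<dots> = prepend a (?m U (?m B C)) + prepend b (?m A (?m V C))
          + frag_cmul lam (prepend (a * b) (?m U (?m V C))) + prepend c (?m A (?m B W))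
          + frag_cmul lam (prepend (a * c) (?m U (?m B W))) + frag_cmul lam (prepend (b * c) (?m A (?m V W)))
          + frag_cmul lam (frag_cmul lam (prepend (a * b * c) (?m U (?m V W))))"
        by (simp only: IH)
      also have "\<dots> = ?m A (?m B C)"
        unfolding mBC
        by (simp only: mshuffle_add_right mshuffle_cmul_right A' prepend_add prepend_cmul
            frag_cmul_distrib2 mult.assoc) (simp only: add_ac)
      finally show ?thesis by (simp only: ABC)
    qed
  qed
  have *: "Poly_Mapping.keys f \<subseteq> UNIV" "Poly_Mapping.keys g \<subseteq> UNIV" "Poly_Mapping.keys h \<subseteq> UNIV"
    by simp_all
  have w1: "?m (?m (frag_of u) (frag_of v)) h = ?m (frag_of u) (?m (frag_of v) h)" for u v
    using *(3) by (induction h rule: frag_induction)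
      (simp_all only: words mshuffle_diff_right mshuffle_zero_right)
  have w2: "?m (?m (frag_of u) g) h = ?m (frag_of u) (?m g h)" for u
    using *(2) by (induction g rule: frag_induction)
      (simp_all only: w1 mshuffle_diff_right mshuffle_diff_left mshuffle_zero_right mshuffle_zero_left)
  show ?thesis
    using *(1) by (induction f rule: frag_induction)
      (simp_all only: w2 mshuffle_diff_left mshuffle_zero_left)
qed

lemma keys_mshuffle:
  "z \<in> Poly_Mapping.keys (mshuffle lam f g) \<Longrightarrow>
    \<exists>u\<in>Poly_Mapping.keys f. \<exists>v\<in>Poly_Mapping.keys g. z \<in> Poly_Mapping.keys (mshuffle_words lam u v)"
  by (auto simp: mshuffle_def dest!: subsetD[OF keys_frag_extend])

lemma keys_mshuffle_words_Cons:
  assumes "z \<in> Poly_Mapping.keys (mshuffle_words lam (a # u) (b # v))"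
  obtains y where "z = a # y" "y \<in> Poly_Mapping.keys (mshuffle_words lam u (b # v))"
  | y where "z = b # y" "y \<in> Poly_Mapping.keys (mshuffle_words lam (a # u) v)"
  | y where "z = (a * b) # y" "y \<in> Poly_Mapping.keys (mshuffle_words lam u v)"
  using assms by (auto dest!: subsetD[OF keys_add] simp: keys_prepend)

text \<open>
  Merging letters shortens a word, so the terms of maximal length are the ordinary shuffles.
\<close>

lemma keys_mshuffle_words:
  assumes "z \<in> Poly_Mapping.keys (mshuffle_words lam u v)"
  shows "length z < length u + length v \<or> length z = length u + length v \<and> z \<in> shuffles u v"
  using assms
proof (induction lam u v arbitrary: z rule: mshuffle_words.induct)
  case (3 lam a u b v)
  from 3(4) show ?case
  proof (cases rule: keys_mshuffle_words_Cons)
    case (1 y)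
    with 3(1)[of y] show ?thesis by auto
  next
    case (2 y)
    with 3(2)[of y] show ?thesis by auto
  next
    case (3 y)
    with "3.IH"(3)[of y] show ?thesis by auto
  qed
qed simp_all

lemma deg_mult [simp]: "deg (a * b) = deg a + deg b"
  by transfer simp

lemma word_deg_mshuffle_words:
  "z \<in> Poly_Mapping.keys (mshuffle_words lam u v) \<Longrightarrow> word_deg z = word_deg u + word_deg v"
proof (induction lam u v arbitrary: z rule: mshuffle_words.induct)
  case (3 lam a u b v)
  from 3(4) show ?case
    by (cases rule: keys_mshuffle_words_Cons) (simp_all add: 3(1-3))
qed simp_all

section \<open>The leading word of a product\<close>

text \<open>
  The leading word of a product of shuffles of \<open>A\<close> and of \<open>B\<close>, when all of \<open>A\<close> is above all of \<open>B\<close>, is reached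
  in exactly one way: from the two maximal shuffles, and by placing all of \<open>u\<close> before \<open>v\<close>. Of the three
  terms of the recursion the merging one is too short, and the one starting with a letter of \<open>v\<close> is
  strictly smaller by \<open>shuffle_of_lyndon_less\<close>. In the remaining one the first letter of \<open>u\<close> has to come from
  the maximum of \<open>A\<close>, and induction applies to the rest.
\<close>

lemma lookup_mshuffle_words_decr_concat:
  fixes u v :: "'s::{linorder,ab_semigroup_mult} list"
  assumes "shuffle_of A u" "shuffle_of B v" "all_lyndon A" "all_lyndon B"
    and "\<And>x y. x \<in># A \<Longrightarrow> y \<in># B \<Longrightarrow> y < x"
  shows "Poly_Mapping.lookup (mshuffle_words lam u v) (decr_concat A @ decr_concat B)
    = (if u = decr_concat A \<and> v = decr_concat B then 1 else 0)"
  using assms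
proof (induction lam u v arbitrary: A B rule: mshuffle_words.induct)
  have nil: "A = {#}" if "shuffle_of A []" "all_lyndon A" for A :: "'s list multiset"
    using that by (cases rule: shuffle_of.cases) (auto simp: lyndon_def)
  {
    case (1 lam v)
    then show ?case using nil[of A] by auto
  next
    case (2 lam a u)
    then show ?case using nil[of B] by auto
  next
    case (3 lam a u b v)
    let ?W = "decr_concat A @ decr_concat B"
    have AB: "decr_concat (A + B) = ?W"
      using 3(8) by (intro decr_concat_union) (simp add: less_imp_le)
    have len: "length ?W = length (a # u) + length (b # v)"
      using 3(4,5) by (simp only: length_decr_concat length_append shuffle_of_length)
    obtain q M where A: "A = add_mset (a # q) M" "shuffle_of (add_mset q M) u"
      using 3(4) by (rule shuffle_of_Cons)
    obtain p N where B: "B = add_mset (b # p) N" "shuffle_of (add_mset p N) v"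
      using 3(5) by (rule shuffle_of_Cons)
    have lynA: "lyndon (a # q)" "all_lyndon M" and lynB: "lyndon (b # p)" "all_lyndon N"
      using 3(6,7) by (simp_all add: A B)
    \<comment> \<open>Words that arise by merging the two first letters are too short.\<close>
    have third: "Poly_Mapping.lookup (prepend (a * b) (mshuffle_words lam u v)) ?W = 0"
    proof (rule ccontr)
      assume "\<not> ?thesis"
      then have "?W \<in> Poly_Mapping.keys (prepend (a * b) (mshuffle_words lam u v))"
        by (simp add: in_keys_iff)
      then obtain z where "?W = (a * b) # z" "z \<in> Poly_Mapping.keys (mshuffle_words lam u v)"
        by (auto simp: keys_prepend)
      with keys_mshuffle_words[OF this(2)] len show False by (simp only: list.size) linarith
    qed
    \<comment> \<open>A first letter from \<open>B\<close> does not come from the maximum of \<open>A + B\<close>.\<close>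
    have second: "Poly_Mapping.lookup (prepend b (mshuffle_words lam (a # u) v)) ?W = 0"
    proof (rule ccontr)
      assume "\<not> ?thesis"
      then have "?W \<in> Poly_Mapping.keys (prepend b (mshuffle_words lam (a # u) v))"
        by (simp add: in_keys_iff)
      then obtain z where z: "?W = b # z" "z \<in> Poly_Mapping.keys (mshuffle_words lam (a # u) v)"
        by (auto simp: keys_prepend)
      with keys_mshuffle_words[OF z(2)] len have "z \<in> shuffles (a # u) v"
        by (simp only: list.size) linarith
      then have "shuffle_of (A + add_mset p N) z"
        using 3(4) B(2) by (rule shuffle_of_shuffles)
      then have "b # z < decr_concat (add_mset (b # p) (A + N))"
        using shuffle_of_lyndon_less[of p "A + N" z b "a # q"] lynA lynB 3(8)[of "a # q" "b # p"]
        by (simp add: A B)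
      also have "\<dots> = ?W" using AB by (simp add: B)
      finally show False using z by simp
    qed
    have first: "Poly_Mapping.lookup (prepend a (mshuffle_words lam u (b # v))) ?W =
      (if a # u = decr_concat A \<and> b # v = decr_concat B then 1 else 0)"
    proof (cases "\<exists>m. m \<in># M \<and> a # q < m")
      case True
      then obtain m where m: "m \<in># M" "a # q < m" by blast
      have "a # u < decr_concat A"
        unfolding A(1) using A(2) lynA m by (intro shuffle_of_lyndon_less)
      moreover have "Poly_Mapping.lookup (prepend a (mshuffle_words lam u (b # v))) ?W = 0"
      proof (rule ccontr)
        assume "\<not> ?thesis"
        then have "?W \<in> Poly_Mapping.keys (prepend a (mshuffle_words lam u (b # v)))"
          by (simp add: in_keys_iff)
        then obtain z where z: "?W = a # z" "z \<in> Poly_Mapping.keys (mshuffle_words lam u (b # v))"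
          by (auto simp: keys_prepend)
        with keys_mshuffle_words[OF z(2)] len have "z \<in> shuffles u (b # v)"
          by (simp only: list.size) linarith
        then have "shuffle_of (add_mset q M + B) z"
          using A(2) 3(5) by (rule shuffle_of_shuffles)
        then have "a # z < decr_concat (add_mset (a # q) (M + B))"
          using shuffle_of_lyndon_less[of q "M + B" z a m] lynA 3(7) m by simp
        also have "\<dots> = ?W" using AB by (simp add: A)
        finally show False using z by simp
      qed
      ultimately show ?thesis by auto
    next
      case False
      \<comment> \<open>The first letter comes from the maximum \<open>a # q\<close>, and all factors of \<open>q\<close> stay above \<open>B\<close>.\<close>
      define A' where "A' = lyndon_factors q + M"
      have le: "y \<le> a # q" if "y \<in># M" for y using False that by force
      have big: "a # q < y" if "y \<in># lyndon_factors q" for y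
        using factors_of_lyndon_suffix[OF lynA(1) that] .
      have "y \<le> x" if "x \<in># lyndon_factors q" "y \<in># M" for x y
        using big[OF that(1)] le[OF that(2)] by simp
      then have "decr_concat A' = q @ decr_concat M"
        by (simp add: A'_def decr_concat_union)
      then have W: "decr_concat A = a # decr_concat A'"
        using le by (simp add: A decr_concat_add_max)
      have "y < x" if "x \<in># A'" "y \<in># B" for x y
      proof (cases "x \<in># M")
        case True
        then show ?thesis using 3(8) that by (simp add: A)
      next
        case False
        then have "a # q < x" using that big by (auto simp: A'_def)
        moreover have "y < a # q" using that 3(8) by (simp add: A)
        ultimately show ?thesis by simp
      qed
      moreover have "shuffle_of A' u" unfolding A'_def using A(2) by (rule shuffle_of_split_factors)
      ultimately have "Poly_Mapping.lookup (mshuffle_words lam u (b # v)) (decr_concat A' @ decr_concat B)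
          = (if u = decr_concat A' \<and> b # v = decr_concat B then 1 else 0)"
        using 3(5,7) lynA by (intro 3(1)) (simp_all add: A'_def)
      then show ?thesis by (simp add: W lookup_prepend)
    qed
    show ?case using first second third by (simp add: lookup_add)
  }
qed

section \<open>The mixable shuffle algebra as a commutative ring\<close>

text \<open>
  A copy of the module of integer combinations of words, on which the type class operations can denote
  the ring structure for \<open>\<lambda> = 1\<close>.
\<close>

typedef 's qsh = "UNIV :: ('s list \<Rightarrow>\<^sub>0 int) set"
  morphisms coeffs Qsh
  by simp

setup_lifting type_definition_qsh

instantiation qsh :: (ab_semigroup_mult) comm_ring_1
begin

lift_definition zero_qsh :: "'a qsh" is 0 .
lift_definition one_qsh :: "'a qsh" is "frag_of []" .
lift_definition plus_qsh :: "'a qsh \<Rightarrow> 'a qsh \<Rightarrow> 'a qsh" is "(+)" .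
lift_definition minus_qsh :: "'a qsh \<Rightarrow> 'a qsh \<Rightarrow> 'a qsh" is "(-)" .
lift_definition uminus_qsh :: "'a qsh \<Rightarrow> 'a qsh" is uminus .
lift_definition times_qsh :: "'a qsh \<Rightarrow> 'a qsh \<Rightarrow> 'a qsh" is "mshuffle 1" .

instance
  by standard
    (transfer; simp add: algebra_simps mshuffle_assoc mshuffle_add_left mshuffle_commute[of 1];
      fail | transfer; rule mshuffle_commute)+

end

unbundle fps_syntax

lift_definition word :: "'s list \<Rightarrow> 's qsh" is frag_of .
lift_definition cons :: "'s \<Rightarrow> 's qsh \<Rightarrow> 's qsh" is prepend .

lemma word_Nil: "word [] = 1"
  by transfer simp

lemma word_Cons: "word (a # w) = cons a (word w)"
  by transfer (simp add: frag_of_Cons)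

lemma cons_zero [simp]: "cons a 0 = 0"
  and cons_diff: "cons a (f - g) = cons a f - cons a g"
  by (transfer; simp add: prepend_diff)+

lemma cons_mult: "cons a f * cons b g
    = cons a (f * cons b g) + cons b (cons a f * g) + cons (a * b) (f * g)"
  by transfer (simp add: mshuffle_prepend)

lemma qsh_induct [case_names word zero diff]:
  assumes "\<And>w. P (word w)" "P 0" "\<And>f g. P f \<Longrightarrow> P g \<Longrightarrow> P (f - g)"
  shows "P f"
  using assms
proof transfer
  fix P :: "('a list \<Rightarrow>\<^sub>0 int) \<Rightarrow> bool" and f :: "'a list \<Rightarrow>\<^sub>0 int"
  assume *: "\<And>w. P (frag_of w)" "P 0" "\<And>f g. P f \<Longrightarrow> P g \<Longrightarrow> P (f - g)"
  have "Poly_Mapping.keys f \<subseteq> UNIV" by simp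
  then show "P f" by (induction f rule: frag_induction) (auto intro: *)
qed

definition coeff :: "'s qsh \<Rightarrow> 's list \<Rightarrow> int"
  where "coeff f w = Poly_Mapping.lookup (coeffs f) w"

lemma coeff_simps [simp]:
  "coeff 0 w = 0" "coeff (f + g) w = coeff f w + coeff g w"
  "coeff (f - g) w = coeff f w - coeff g w" "coeff (- f) w = - coeff f w"
  "coeff (word v) w = (if w = v then 1 else 0)"
  "coeff (cons a f) [] = 0" "coeff (cons a f) (b # w) = (if b = a then coeff f w else 0)"
  "coeff 1 w = (if w = [] then 1 else 0)"
  by (simp_all add: coeff_def zero_qsh.rep_eq plus_qsh.rep_eq minus_qsh.rep_eq uminus_qsh.rep_eq
      word.rep_eq cons.rep_eq one_qsh.rep_eq lookup_add lookup_minus lookup_prepend)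

lemma qsh_eqI: "(\<And>w. coeff f w = coeff g w) \<Longrightarrow> f = g"
  by (auto simp: coeff_def coeffs_inject[symmetric] intro: poly_mapping_eqI)

lemma coeff_sum [simp]: "coeff (sum f A) w = (\<Sum>x\<in>A. coeff (f x) w)"
  by (induction A rule: infinite_finite_induct) simp_all

lemma coeff_of_nat_mult [simp]: "coeff (of_nat n * f) w = int n * coeff f w"
  by (induction n) (simp_all add: algebra_simps)

lemma coeff_of_int_mult [simp]: "coeff (of_int c * f) w = c * coeff f w"
  by (cases c rule: int_cases2) simp_all

lemma qsh_torsion_free: "n > 0 \<Longrightarrow> of_nat n * f = 0 \<Longrightarrow> f = 0" for f :: "'s::ab_semigroup_mult qsh"
proof (rule qsh_eqI)
  fix w assume "n > 0" "of_nat n * f = 0"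
  then have "coeff (of_nat n * f) w = 0" by simp
  with \<open>n > 0\<close> show "coeff f w = coeff 0 w" by simp
qed

section \<open>Linear extension from a basis\<close>

text \<open>
  Unlike \<^const>\<open>frag_extend\<close>, the values may lie in any ring.
\<close>

definition lin_ext :: "('k \<Rightarrow> 'b::ring_1) \<Rightarrow> ('k \<Rightarrow>\<^sub>0 int) \<Rightarrow> 'b"
  where "lin_ext g p = (\<Sum>k\<in>Poly_Mapping.keys p. of_int (Poly_Mapping.lookup p k) * g k)"

lemma lin_ext_superset:
  "finite K \<Longrightarrow> Poly_Mapping.keys p \<subseteq> K \<Longrightarrow>
    lin_ext g p = (\<Sum>k\<in>K. of_int (Poly_Mapping.lookup p k) * g k)"
  unfolding lin_ext_def by (intro sum.mono_neutral_left) (auto simp: in_keys_iff)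

lemma lin_ext_zero [simp]: "lin_ext g 0 = 0"
  by (simp add: lin_ext_def)

lemma lin_ext_frag_of [simp]: "lin_ext g (frag_of k) = g k"
  by (simp add: lin_ext_def)

lemma lin_ext_diff: "lin_ext g (p - q) = lin_ext g p - lin_ext g q"
proof -
  let ?K = "Poly_Mapping.keys p \<union> Poly_Mapping.keys q"
  have "finite ?K" "Poly_Mapping.keys (p - q) \<subseteq> ?K" "Poly_Mapping.keys p \<subseteq> ?K" "Poly_Mapping.keys q \<subseteq> ?K"
    using keys_diff[of p q] by auto
  then show ?thesis
    by (simp add: lin_ext_superset[where K = ?K] lookup_minus sum_subtractf left_diff_distrib)
qed

lemma lin_ext_add: "lin_ext g (p + q) = lin_ext g p + lin_ext g q"
  using lin_ext_diff[of g "p + q" q] by simp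

definition ring_hom_on_type :: "('a::ring_1 \<Rightarrow> 'b::ring_1) \<Rightarrow> bool"
  where "ring_hom_on_type h \<longleftrightarrow>
    h 1 = 1 \<and> (\<forall>x y. h (x + y) = h x + h y) \<and> (\<forall>x y. h (x * y) = h x * h y)"

context
  fixes h :: "'a::ring_1 \<Rightarrow> 'b::ring_1"
  assumes hom: "ring_hom_on_type h"
begin

lemma hom_one: "h 1 = 1" and hom_add: "h (x + y) = h x + h y" and hom_mult: "h (x * y) = h x * h y"
  using hom by (auto simp: ring_hom_on_type_def)

lemma hom_zero: "h 0 = 0"
  using hom_add[of 0 0] by simp

lemma hom_minus: "h (- x) = - h x"
  using hom_add[of x "- x"] by (simp add: hom_zero add_eq_0_iff)

lemma hom_diff: "h (x - y) = h x - h y"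
  using hom_add[of x "- y"] by (simp add: hom_minus)

lemma hom_sum: "h (sum f A) = (\<Sum>x\<in>A. h (f x))"
  by (induction A rule: infinite_finite_induct) (simp_all add: hom_zero hom_add)

lemma hom_power: "h (x ^ n) = h x ^ n"
  by (induction n) (simp_all add: hom_one hom_mult)

lemma hom_of_nat: "h (of_nat n) = of_nat n"
  by (induction n) (simp_all add: hom_zero hom_one hom_add)

end

section \<open>Separating off the first letter\<close>

abbreviation const :: "'r::zero \<Rightarrow> ('x multiset \<Rightarrow>\<^sub>0 'r)"
  where "const \<equiv> Poly_Mapping.single 0"

text \<open>
  Restricting the variables of a quasi-symmetric function to \<open>x\<^sub>0, x\<^sub>1, \<dots>\<close> and singling out \<open>x\<^sub>0\<close> writes it as a
  polynomial in \<open>x\<^sub>0\<close> whose coefficients are quasi-symmetric in \<open>x\<^sub>1, x\<^sub>2, \<dots>\<close>: a word either avoids \<open>x\<^sub>0\<close>, or its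
  first letter is evaluated at \<open>x\<^sub>0\<close>. Monomials in \<open>x\<^sub>0\<close> are multisets of generators, and the empty
  multiset is the monomial 1.
\<close>

fun split_word :: "'x free_semigroup list \<Rightarrow> ('x multiset \<Rightarrow>\<^sub>0 'x free_semigroup qsh)" where
  "split_word [] = 1"
| "split_word (a # w) = const (word (a # w)) + Poly_Mapping.single (mset_of a) (word w)"

definition split_first :: "'x free_semigroup qsh \<Rightarrow> ('x multiset \<Rightarrow>\<^sub>0 'x free_semigroup qsh)"
  where "split_first f = lin_ext split_word (coeffs f)"

lemma split_first_word [simp]: "split_first (word w) = split_word w"
  and split_first_zero [simp]: "split_first 0 = 0"
  and split_first_diff: "split_first (f - g) = split_first f - split_first g"
  and split_first_add: "split_first (f + g) = split_first f + split_first g"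
  by (simp_all add: split_first_def word.rep_eq zero_qsh.rep_eq minus_qsh.rep_eq plus_qsh.rep_eq
      lin_ext_diff lin_ext_add)

lemma split_first_cons:
  "split_first (cons a f) = const (cons a f) + Poly_Mapping.single (mset_of a) f"
proof (induction f rule: qsh_induct)
  case (word w)
  then show ?case by (simp flip: word_Cons)
next
  case (diff f g)
  then show ?case by (simp add: cons_diff split_first_diff single_diff)
qed simp

lemma mset_of_mult: "mset_of (a * b) = mset_of a + mset_of b"
  by transfer simp

lemma split_first_one [simp]: "split_first 1 = 1"
  by (metis word_Nil split_first_word split_word.simps(1))

text \<open>
  The recursion of the product is the expansion of \<open>(u + a u') (v + b v')\<close> with \<open>u = a \<otimes> u'\<close> and
  \<open>v = b \<otimes> v'\<close>.
\<close>

lemma split_first_mult_words: "split_first (word u * word v) = split_first (word u) * split_first (word v)"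
proof (induction "1 :: int" u v rule: mshuffle_words.induct)
  case (3 a u b v)
  have "split_first (word (a # u) * word (b # v)) =
    const (word (a # u) * word (b # v)) + Poly_Mapping.single (mset_of a) (word u * word (b # v))
    + Poly_Mapping.single (mset_of b) (word (a # u) * word v)
    + Poly_Mapping.single (mset_of a + mset_of b) (word u * word v)"
    unfolding word_Cons cons_mult
    by (simp add: split_first_add split_first_cons mset_of_mult single_add)
  also have "\<dots> = split_first (word (a # u)) * split_first (word (b # v))"
    by (simp add: mult_single algebra_simps)
  finally show ?case .
qed (simp_all add: word_Nil)

lemma split_first_mult: "split_first (f * g) = split_first f * split_first g"
proof -
  have "split_first (word u * g) = split_first (word u) * split_first g" for u
  proof (induction g rule: qsh_induct)
    case (diff f g)
    then show ?case by (simp only: split_first_diff right_diff_distrib)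
  qed (simp_all only: split_first_mult_words split_first_zero mult_zero_right)
  then show ?thesis
  proof (induction f rule: qsh_induct)
    case (diff f g)
    then show ?case by (simp only: split_first_diff left_diff_distrib)
  qed (simp_all only: split_first_zero mult_zero_left)
qed

lemma split_first_hom: "ring_hom_on_type split_first"
  by (simp add: ring_hom_on_type_def split_first_add split_first_mult)

lemma const_hom: "ring_hom_on_type (const :: 'r::ring_1 \<Rightarrow> 'x multiset \<Rightarrow>\<^sub>0 'r)"
  by (simp add: ring_hom_on_type_def single_add mult_single)

lemma coeff_split_first: "coeff (Poly_Mapping.lookup (split_first f) (mset_of a)) w = coeff f (a # w)"
proof (induction f rule: qsh_induct)
  case (word v)
  have "mset_of a \<noteq> {#}" using mset_of[of a] by simp
  then show ?case
    by (cases v) (auto simp: lookup_add lookup_single lookup_one when_def mset_of_inject)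
next
  case (diff f g)
  then show ?case by (simp add: split_first_diff lookup_minus)
qed simp

text \<open>
  An element that does not involve \<open>x\<^sub>0\<close> is constant. This turns \<open>split_first\<close> into a tool for proving
  identities: both sides need only agree after splitting and in their constant terms.
\<close>

lemma split_first_eq_const:
  assumes "split_first f = const f" "coeff f [] = 0"
  shows "f = 0"
proof (rule qsh_eqI)
  fix w show "coeff f w = coeff 0 w"
  proof (cases w)
    case (Cons a v)
    have "mset_of a \<noteq> {#}" using mset_of[of a] by simp
    then show ?thesis
      using coeff_split_first[of f a v] assms(1) Cons by (simp add: lookup_single)
  qed (use assms in simp)
qed

lemma coeff_mult_Nil: "coeff (f * g) [] = coeff f [] * coeff g []"
proof -
  have words: "coeff (word u * word v) [] = coeff (word u) [] * coeff (word v) []" for u v :: "'a list"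
  proof (cases "u = [] \<or> v = []")
    case False
    then show ?thesis by (auto simp: neq_Nil_conv word_Cons cons_mult)
  qed (auto simp: word_Nil)
  have "coeff (word u * g) [] = coeff (word u) [] * coeff g []" for u
    by (induction g rule: qsh_induct) (simp_all only: words right_diff_distrib coeff_simps(1,3) mult_zero_right)
  then show ?thesis
    by (induction f rule: qsh_induct) (simp_all only: left_diff_distrib coeff_simps(1,3) mult_zero_left)
qed

section \<open>Powers of letters and words\<close>

text \<open>
  There is no zeroth power in the semigroup; the value for exponent 0 is a default.
\<close>

lift_definition letter_power :: "nat \<Rightarrow> 'x free_semigroup \<Rightarrow> 'x free_semigroup"
  is "\<lambda>n m. if n = 0 then m else repeat_mset n m"
  by (simp flip: size_eq_0_iff_empty)

abbreviation word_power :: "nat \<Rightarrow> 'x free_semigroup list \<Rightarrow> 'x free_semigroup list"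
  where "word_power n \<equiv> map (letter_power n)"

lemma mset_of_letter_power: "n > 0 \<Longrightarrow> mset_of (letter_power n a) = repeat_mset n (mset_of a)"
  by transfer simp

lemma letter_power_one [simp]: "letter_power 1 a = a" "letter_power (Suc 0) a = a"
  by (transfer; simp)+

lemma letter_power_mult: "m > 0 \<Longrightarrow> n > 0 \<Longrightarrow> letter_power m (letter_power n a) = letter_power (m * n) a"
  by transfer simp

lemma deg_letter_power: "n > 0 \<Longrightarrow> deg (letter_power n a) = n * deg a"
  by transfer simp

lemma word_deg_word_power: "n > 0 \<Longrightarrow> word_deg (word_power n w) = n * word_deg w"
  by (induction w) (simp_all add: deg_letter_power algebra_simps)

section \<open>Elementary symmetric functions of a word\<close>

text \<open>
  The \<open>n\<close>-th elementary symmetric function of the monomials of a word. A choice of \<open>n\<close> distinct monomials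
  of \<open>a \<otimes> v\<close> is grouped by the smallest variable index that occurs: \<open>j \<ge> 1\<close> of the monomials use it
  and contribute \<open>a\<^sup>j\<close> there and an elementary symmetric function of \<open>v\<close> afterwards, while the other \<open>n - j\<close> lie
  entirely in the later variables. The empty word has the single monomial 1.
\<close>

fun esym :: "'x free_semigroup list \<Rightarrow> nat \<Rightarrow> 'x free_semigroup qsh" where
  "esym [] n = (if n \<le> 1 then 1 else 0)"
| "esym (a # v) n = (if n = 0 then 1 else
    (\<Sum>j = 1..n. cons (letter_power j a) (esym (a # v) (n - j) * esym v j)))"

declare esym.simps(2) [simp del]

lemma esym_0 [simp]: "esym v 0 = 1"
  by (cases v) (simp_all add: esym.simps)

text \<open>
  In terms of generating series: the monomials of \<open>a \<otimes> v\<close> are those without \<open>x\<^sub>0\<close> and the products of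
  \<open>a(x\<^sub>0)\<close> with the monomials of \<open>v\<close> in the later variables.
\<close>

lemma split_first_esym: "split_first (esym (a # v) n) =
  (\<Sum>j\<le>n. Poly_Mapping.single (repeat_mset j (mset_of a)) (esym (a # v) (n - j) * esym v j))"
proof (cases "n = 0")
  case True
  then show ?thesis by (simp add: hom_one[OF split_first_hom])
next
  case False
  let ?t = "\<lambda>j. esym (a # v) (n - j) * esym v j"
  have "split_first (esym (a # v) n) = split_first (\<Sum>j = 1..n. cons (letter_power j a) (?t j))"
    using False by (simp add: esym.simps)
  also have "\<dots> = const (\<Sum>j = 1..n. cons (letter_power j a) (?t j))
      + (\<Sum>j = 1..n. Poly_Mapping.single (mset_of (letter_power j a)) (?t j))"
    by (simp add: hom_sum[OF split_first_hom] hom_sum[OF const_hom] split_first_cons sum.distrib)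
  also have "(\<Sum>j = 1..n. cons (letter_power j a) (?t j)) = ?t 0"
    using False by (simp add: esym.simps)
  also have "(\<Sum>j = 1..n. Poly_Mapping.single (mset_of (letter_power j a)) (?t j))
      = (\<Sum>j = 1..n. Poly_Mapping.single (repeat_mset j (mset_of a)) (?t j))"
    by (intro sum.cong) (simp_all add: mset_of_letter_power)
  also have "const (?t 0) + \<dots> = (\<Sum>j\<le>n. Poly_Mapping.single (repeat_mset j (mset_of a)) (?t j))"
    by (simp add: atMost_atLeast0 sum.atLeast_Suc_atMost)
  finally show ?thesis .
qed

text \<open>
  The series \<open>\<Prod> (1 - m t)\<close> and \<open>\<Sum> m\<^sup>n t\<^sup>n\<close>, \<open>n \<ge> 1\<close>, over the monomials \<open>m\<close> of \<open>v\<close>.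
\<close>

definition esym_series :: "'x free_semigroup list \<Rightarrow> 'x free_semigroup qsh fps"
  where "esym_series v = Abs_fps (\<lambda>n. (-1) ^ n * esym v n)"

definition power_sum_series :: "'x free_semigroup list \<Rightarrow> 'x free_semigroup qsh fps"
  where "power_sum_series v = Abs_fps (\<lambda>n. if n = 0 then 0 else word (word_power n v))"

definition fps_map :: "('a \<Rightarrow> 'b) \<Rightarrow> 'a fps \<Rightarrow> 'b fps"
  where "fps_map h F = Abs_fps (\<lambda>n. h (F $ n))"

lemma fps_map_nth [simp]: "fps_map h F $ n = h (F $ n)"
  by (simp add: fps_map_def)

lemma X_deriv_nth: "(fps_X * fps_deriv F) $ n = of_nat n * F $ n" for F :: "'a::comm_ring_1 fps"
  by (cases n) simp_all

lemma fps_map_mult: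
  "ring_hom_on_type h \<Longrightarrow> fps_map h (F * G) = fps_map h F * fps_map h G"
  by (rule fps_ext) (simp add: fps_mult_nth hom_sum hom_mult)

lemma fps_map_diff: "ring_hom_on_type h \<Longrightarrow> fps_map h (F - G) = fps_map h F - fps_map h G"
  and fps_map_minus: "ring_hom_on_type h \<Longrightarrow> fps_map h (- F) = - fps_map h F"
  by (rule fps_ext, simp add: hom_diff hom_minus)+

lemma fps_map_X_deriv:
  fixes h :: "'a::comm_ring_1 \<Rightarrow> 'b::comm_ring_1"
  shows "ring_hom_on_type h \<Longrightarrow> fps_map h (fps_X * fps_deriv F) = fps_X * fps_deriv (fps_map h F)"
  by (rule fps_ext) (simp only: X_deriv_nth fps_map_nth hom_mult hom_of_nat)

text \<open>
  The difference of the two sides of Newton's identity \<open>-t F' = F P\<close> is natural in the coefficient ring.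
\<close>

lemma fps_map_Newton_defect:
  fixes h :: "'a::comm_ring_1 \<Rightarrow> 'b::comm_ring_1"
  assumes "ring_hom_on_type h"
  shows "fps_map h (- (fps_X * fps_deriv F) - F * P)
    = - (fps_X * fps_deriv (fps_map h F)) - fps_map h F * fps_map h P"
  using assms by (simp only: fps_map_diff fps_map_minus fps_map_X_deriv) (simp only: fps_map_mult)

text \<open>
  Replaces the series variable \<open>t\<close> by \<open>m(x\<^sub>0) t\<close>.
\<close>

definition twist :: "'x multiset \<Rightarrow> 'r::comm_ring_1 fps \<Rightarrow> ('x multiset \<Rightarrow>\<^sub>0 'r) fps"
  where "twist m F = Abs_fps (\<lambda>n. Poly_Mapping.single (repeat_mset n m) (F $ n))"

lemma twist_nth [simp]: "twist m F $ n = Poly_Mapping.single (repeat_mset n m) (F $ n)"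
  by (simp add: twist_def)

lemma twist_mult: "twist m (F * G) = twist m F * twist m G"
proof (rule fps_ext)
  fix n
  have sum: "Poly_Mapping.single k (sum f A) = (\<Sum>x\<in>A. Poly_Mapping.single k (f x))"
    for k :: "'a multiset" and f :: "nat \<Rightarrow> 'b" and A
    by (induction A rule: infinite_finite_induct) (simp_all add: single_add)
  show "twist m (F * G) $ n = (twist m F * twist m G) $ n"
    by (simp add: fps_mult_nth sum mult_single flip: repeat_mset_distrib)
qed

lemma single_of_nat_mult:
  "Poly_Mapping.single k (of_nat n * x) = of_nat n * Poly_Mapping.single k x" for x :: "'r::comm_ring_1"
  by (induction n) (simp_all add: single_add algebra_simps)

lemma twist_X_deriv: "twist m (fps_X * fps_deriv F) = fps_X * fps_deriv (twist m F)"
  by (rule fps_ext) (simp only: X_deriv_nth twist_nth single_of_nat_mult)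

lemma coeff_esym_Nil: "coeff (esym (a # v) n) [] = (if n = 0 then 1 else 0)"
  by (simp add: esym.simps)

text \<open>
  Newton's identity. Splitting off \<open>x\<^sub>0\<close> turns the elementary series of \<open>a \<otimes> v\<close> into its product with the
  twisted series of \<open>v\<close>, and the power sum series into the corresponding sum. As the identity is known for \<open>v\<close>,
  the defect \<open>D\<close> of the identity for \<open>a \<otimes> v\<close> splits into \<open>D\<close> times a series with constant term 1, so
  each coefficient of \<open>D\<close> is constant once the earlier ones vanish, and it has no constant term.
\<close>

theorem Newton_identity: "- (fps_X * fps_deriv (esym_series v)) = esym_series v * power_sum_series v"
proof (induction v)
  case Nil
  have "esym_series [] = (1 - fps_X :: 'a free_semigroup qsh fps)"
    by (rule fps_ext) (auto simp: esym_series_def)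
  then show ?case
    by (auto intro!: fps_ext simp: X_deriv_nth power_sum_series_def word_Nil left_diff_distrib)
next
  case (Cons a v)
  let ?E = "esym_series (a # v)" and ?P = "power_sum_series (a # v)"
  let ?\<tau> = "twist (mset_of a)"
  define D where "D = - (fps_X * fps_deriv ?E) - ?E * ?P"
  note T = split_first_hom and C = const_hom
  have sgn: "split_first ((-1) ^ n) = (-1) ^ n" "const ((-1 :: 'a free_semigroup qsh) ^ n) = ((-1) ^ n :: 'a multiset \<Rightarrow>\<^sub>0 'a free_semigroup qsh)" for n
    by (simp_all add: hom_power[OF T] hom_power[OF C] hom_minus[OF T] hom_minus[OF C] hom_one[OF T] hom_one[OF C])
  have TE: "fps_map split_first ?E = fps_map const ?E * ?\<tau> (esym_series v)"
  proof (rule fps_ext)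
    fix n
    have "fps_map split_first ?E $ n = (-1) ^ n * split_first (esym (a # v) n)"
      by (simp add: esym_series_def hom_mult[OF T] sgn)
    also have "\<dots> = (\<Sum>j\<le>n. (-1) ^ n * Poly_Mapping.single (repeat_mset j (mset_of a))
        (esym (a # v) (n - j) * esym v j))"
      by (simp add: split_first_esym sum_distrib_left)
    also have "\<dots> = (\<Sum>j\<le>n. const (?E $ (n - j)) * ?\<tau> (esym_series v) $ j)"
    proof (rule sum.cong)
      fix j assume "j \<in> {..n}"
      then have pw: "(-1 :: 'a free_semigroup qsh) ^ n = (-1) ^ (n - j) * (-1) ^ j"
        by (simp flip: power_add)
      have pull: "(-1) ^ n * Poly_Mapping.single k x = Poly_Mapping.single k ((-1) ^ n * x)"
        for k :: "'a multiset" and x :: "'a free_semigroup qsh"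
        by (simp add: mult_single flip: sgn(2))
      show "(-1) ^ n * Poly_Mapping.single (repeat_mset j (mset_of a))
          (esym (a # v) (n - j) * esym v j) = const (?E $ (n - j)) * ?\<tau> (esym_series v) $ j"
        by (simp only: pull pw) (simp add: mult_single esym_series_def mult_ac)
    qed simp
    also have "\<dots> = (fps_map const ?E * ?\<tau> (esym_series v)) $ n"
      unfolding mult.commute[of "fps_map const ?E" "?\<tau> (esym_series v)"] fps_mult_nth
      by (simp only: atMost_atLeast0 fps_map_nth mult.commute)
    finally show "fps_map split_first ?E $ n = (fps_map const ?E * ?\<tau> (esym_series v)) $ n" .
  qed
  have TP: "fps_map split_first ?P = fps_map const ?P + ?\<tau> (power_sum_series v)"
    by (rule fps_ext) (simp add: power_sum_series_def mset_of_letter_power)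
  have "fps_map split_first D = fps_map const D * ?\<tau> (esym_series v)"
  proof -
    let ?E1 = "fps_map const ?E" and ?E2 = "?\<tau> (esym_series v)"
      and ?P1 = "fps_map const ?P" and ?P2 = "?\<tau> (power_sum_series v)"
    have "?\<tau> (- (fps_X * fps_deriv (esym_series v))) = ?E2 * ?P2"
      by (simp only: Cons.IH twist_mult)
    moreover have "?\<tau> (- F) = - ?\<tau> F" for F :: "'a free_semigroup qsh fps"
      by (rule fps_ext) (simp add: single_uminus)
    ultimately have E2: "- (fps_X * fps_deriv ?E2) = ?E2 * ?P2"
      by (simp only: twist_X_deriv)
    have "fps_map split_first D = - (fps_X * fps_deriv (?E1 * ?E2)) - (?E1 * ?E2) * (?P1 + ?P2)"
      unfolding D_def by (simp only: fps_map_Newton_defect[OF T] TE TP)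
    also have "\<dots> = (- (fps_X * fps_deriv ?E1) - ?E1 * ?P1) * ?E2
        + ?E1 * (- (fps_X * fps_deriv ?E2) - ?E2 * ?P2)"
      by (simp add: algebra_simps)
    also have "\<dots> = (- (fps_X * fps_deriv ?E1) - ?E1 * ?P1) * ?E2"
      by (simp add: E2)
    also have "- (fps_X * fps_deriv ?E1) - ?E1 * ?P1 = fps_map const D"
      unfolding D_def by (simp only: fps_map_Newton_defect[OF C])
    finally show ?thesis .
  qed
  from arg_cong[OF this, of "\<lambda>F. F $ n" for n]
  have split: "split_first (D $ n) = (\<Sum>i=0..n. const (D $ i) * ?\<tau> (esym_series v) $ (n - i))" for n
    by (simp only: fps_map_nth fps_mult_nth)
  have "D $ n = 0" for n
  proof (induction n rule: less_induct)
    case (less n)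
    have "(\<Sum>i=0..n. const (D $ i) * ?\<tau> (esym_series v) $ (n - i)) =
      (\<Sum>i\<in>{n}. const (D $ i) * ?\<tau> (esym_series v) $ (n - i))"
      using less by (intro sum.mono_neutral_right) auto
    also have "\<dots> = const (D $ n)"
      by (simp add: esym_series_def)
    finally have "split_first (D $ n) = const (D $ n)" using split by simp
    moreover have "coeff (D $ n) [] = 0"
    proof -
      have "coeff ((-1) ^ k * f) [] = (-1) ^ k * coeff f []" for k and f :: "'a free_semigroup qsh"
        by (induction k) simp_all
      then have "coeff (?E $ k) [] = (if k = 0 then 1 else 0)" for k
        by (simp add: esym_series_def coeff_esym_Nil)
      moreover have "coeff (?P $ k) [] = 0" for k
        by (simp add: power_sum_series_def)
      ultimately show ?thesis
        by (simp add: D_def X_deriv_nth fps_mult_nth coeff_mult_Nil)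
    qed
    ultimately show "D $ n = 0" by (rule split_first_eq_const)
  qed
  then have "D = 0" by (intro fps_ext) simp
  then show ?case by (simp add: D_def)
qed

section \<open>Power sums of a formal power series\<close>

text \<open>
  If \<open>F = \<Prod> (1 - x\<^sub>i t)\<close>, then \<open>L\<close> is the series of the power sums of the \<open>x\<^sub>i\<close> of exponent at least 1.
\<close>

definition power_sums :: "'a::comm_ring_1 fps \<Rightarrow> 'a fps \<Rightarrow> bool"
  where "power_sums F L \<longleftrightarrow> - (fps_X * fps_deriv F) = F * L"

lemma power_sums_one: "power_sums 1 0"
  by (simp add: power_sums_def)

lemma power_sums_mult: "power_sums F L \<Longrightarrow> power_sums G M \<Longrightarrow> power_sums (F * G) (L + M)"
proof -
  assume FG: "power_sums F L" "power_sums G M"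
  have "- (fps_X * fps_deriv (F * G)) = - (fps_X * fps_deriv F) * G + F * (- (fps_X * fps_deriv G))"
    by (simp add: algebra_simps)
  also have "\<dots> = F * G * (L + M)"
    using FG by (simp only: power_sums_def) (simp add: algebra_simps)
  finally show ?thesis by (simp add: power_sums_def)
qed

lemma power_sums_power: "power_sums F L \<Longrightarrow> power_sums (F ^ k) (of_nat k * L)"
  by (induction k) (auto simp: power_sums_one algebra_simps dest: power_sums_mult)

lemma power_sums_prod:
  "(\<And>i. i \<in> I \<Longrightarrow> power_sums (F i) (L i)) \<Longrightarrow> power_sums (\<Prod>i\<in>I. F i) (\<Sum>i\<in>I. L i)"
  by (induction I rule: infinite_finite_induct) (simp_all add: power_sums_one power_sums_mult)

definition binomial_series :: "nat \<Rightarrow> 'a::comm_ring_1 \<Rightarrow> 'a fps"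
  where "binomial_series d q = 1 - fps_const q * fps_X ^ d"

text \<open>
  The power sums that belong to \<open>1 - q t\<^sup>d\<close>: its reciprocal roots are the \<open>d\<close>-th roots of \<open>q\<close>, whose \<open>n\<close>-th
  powers sum to \<open>d q\<^bsup>n/d\<^esup>\<close> if \<open>d\<close> divides \<open>n\<close> and to 0 otherwise.
\<close>

definition binomial_power_sums :: "nat \<Rightarrow> 'a::comm_ring_1 \<Rightarrow> 'a fps"
  where "binomial_power_sums d q =
    Abs_fps (\<lambda>n. if n > 0 \<and> d dvd n then of_nat d * q ^ (n div d) else 0)"

lemma mult_X_power_nth: "(fps_const q * fps_X ^ d * F) $ n = (if n < d then 0 else q * F $ (n - d))"
  for F :: "'a::comm_ring_1 fps"
  by (simp add: mult.assoc fps_X_power_mult_nth)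

lemma power_sums_binomial:
  assumes "d > 0"
  shows "power_sums (binomial_series d q) (binomial_power_sums d q)"
  unfolding power_sums_def
proof (rule fps_ext)
  fix n
  let ?P = "binomial_power_sums d q"
  have R: "(binomial_series d q * ?P) $ n = ?P $ n - (if n < d then 0 else q * ?P $ (n - d))"
    by (simp add: binomial_series_def left_diff_distrib mult_X_power_nth del: fps_const_mult_apply_left)
  have L: "(- (fps_X * fps_deriv (binomial_series d q))) $ n = (if n = d then of_nat d * q else 0)"
    using assms by (simp add: X_deriv_nth binomial_series_def fps_X_power_nth)
  consider "n < d" | "n = d" | "n > d" by linarith
  then show "(- (fps_X * fps_deriv (binomial_series d q))) $ n = (binomial_series d q * ?P) $ n"
  proof cases
    case 3
    then obtain m where m: "n = d + m" "m > 0" by (metis less_imp_add_positive)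
    show ?thesis unfolding L R
      using m assms by (simp add: binomial_power_sums_def)
  qed (unfold L R, use assms in \<open>auto simp: binomial_power_sums_def dest: dvd_imp_le\<close>)
qed

lemma power_sums_nth: "power_sums F L \<Longrightarrow> (F * L) $ n = - (of_nat n * F $ n)"
  by (metis X_deriv_nth fps_neg_nth power_sums_def)

lemma power_sums_determined:
  assumes "power_sums F L" "power_sums G M" "F $ 0 = 1" "\<And>k. k \<le> N \<Longrightarrow> F $ k = G $ k" "n \<le> N"
  shows "L $ n = M $ n"
  using \<open>n \<le> N\<close>
proof (induction n rule: less_induct)
  case (less n)
  have split: "(F * L) $ n = F $ 0 * L $ n + (\<Sum>i\<in>{1..n}. F $ i * L $ (n - i))" for F L :: "'a fps"
    by (simp add: fps_mult_nth sum.atLeast_Suc_atMost)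
  have "(F * L) $ n = (G * M) $ n"
    using assms(4) less.prems by (simp add: power_sums_nth[OF assms(1)] power_sums_nth[OF assms(2)])
  moreover have "(\<Sum>i\<in>{1..n}. F $ i * L $ (n - i)) = (\<Sum>i\<in>{1..n}. G $ i * M $ (n - i))"
    using less assms(4) by (intro sum.cong) simp_all
  ultimately show ?case
    using assms(3) assms(4)[of 0] by (simp add: split)
qed

lemma determined_by_power_sums:
  assumes "power_sums F L" "power_sums G M" "F $ 0 = G $ 0" "L $ 0 = 0" "M $ 0 = 0"
    and "\<And>k. k \<le> N \<Longrightarrow> L $ k = M $ k" "n \<le> N"
    and torsion_free: "\<And>n x::'a::comm_ring_1. n > 0 \<Longrightarrow> of_nat n * x = 0 \<Longrightarrow> x = 0"
  shows "F $ n = (G $ n :: 'a)"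
  using \<open>n \<le> N\<close>
proof (induction n rule: less_induct)
  case (less n)
  show ?case
  proof (cases "n = 0")
    case False
    have "(F * L) $ n = (G * M) $ n"
      unfolding fps_mult_nth
    proof (rule sum.cong)
      fix i assume "i \<in> {0..n}"
      then show "F $ i * L $ (n - i) = G $ i * M $ (n - i)"
        using less assms(4-6) by (cases "i = n") simp_all
    qed simp
    then have "of_nat n * (F $ n - G $ n) = 0"
      by (simp add: power_sums_nth[OF assms(1)] power_sums_nth[OF assms(2)] right_diff_distrib)
    with False torsion_free[of n "F $ n - G $ n"] show ?thesis by simp
  qed (simp add: assms(3))
qed

section \<open>Power sums of \<open>g\<close>-th powers\<close>

definition is_subring :: "'a::comm_ring_1 set \<Rightarrow> bool"
  where "is_subring B \<longleftrightarrow> 1 \<in> B \<and> (\<forall>x\<in>B. \<forall>y\<in>B. x - y \<in> B \<and> x * y \<in> B)"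

lemma
  assumes "is_subring B"
  shows subring_one: "1 \<in> B" and subring_zero: "0 \<in> B"
    and subring_diff: "x \<in> B \<Longrightarrow> y \<in> B \<Longrightarrow> x - y \<in> B"
    and subring_mult: "x \<in> B \<Longrightarrow> y \<in> B \<Longrightarrow> x * y \<in> B"
    and subring_add: "x \<in> B \<Longrightarrow> y \<in> B \<Longrightarrow> x + y \<in> B"
proof -
  note B = assms[unfolded is_subring_def]
  show "1 \<in> B" using B by blast
  show 0: "0 \<in> B" using B by (metis diff_self)
  show "x \<in> B \<Longrightarrow> y \<in> B \<Longrightarrow> x - y \<in> B" "x \<in> B \<Longrightarrow> y \<in> B \<Longrightarrow> x * y \<in> B"
    using B by blast+
  show "x + y \<in> B" if "x \<in> B" "y \<in> B"
  proof -
    have "x - (0 - y) \<in> B" using B 0 that by blast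
    then show ?thesis by simp
  qed
qed

lemma subring_sum: "is_subring B \<Longrightarrow> (\<And>i. i \<in> I \<Longrightarrow> f i \<in> B) \<Longrightarrow> sum f I \<in> B"
  by (induction I rule: infinite_finite_induct) (auto intro: subring_zero subring_add)

lemma subring_prod: "is_subring B \<Longrightarrow> (\<And>i. i \<in> I \<Longrightarrow> f i \<in> B) \<Longrightarrow> prod f I \<in> B"
  by (induction I rule: infinite_finite_induct) (auto intro: subring_one subring_mult)

lemma subring_power: "is_subring B \<Longrightarrow> x \<in> B \<Longrightarrow> x ^ n \<in> B"
  by (induction n) (auto intro: subring_one subring_mult)

lemma subring_of_int: assumes "is_subring B" shows "of_int c \<in> B"
proof -
  have "of_nat n \<in> B" for n
    by (induction n) (auto intro: assms subring_zero subring_one subring_add)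
  then show ?thesis
    using subring_diff[OF assms subring_zero[OF assms]] by (cases c rule: int_cases2) force+
qed

lemma is_subring_fps: "is_subring B \<Longrightarrow> is_subring {F. \<forall>n. F $ n \<in> B}"
  unfolding is_subring_def[of "{F. \<forall>n. F $ n \<in> B}"]
  by (auto simp: fps_mult_nth subring_zero subring_one intro!: subring_diff subring_sum subring_mult)

lemma fps_const_in: "is_subring B \<Longrightarrow> c \<in> B \<Longrightarrow> fps_const c \<in> {F. \<forall>n. F $ n \<in> B}"
  by (auto simp: subring_zero)

lemma fps_X_power_in: "is_subring B \<Longrightarrow> fps_X ^ d \<in> {F. \<forall>n. F $ n \<in> B}"
  by (auto simp: subring_zero subring_one fps_X_power_nth)

lemma binomial_series_in:
  assumes "is_subring B" "q \<in> B"
  shows "binomial_series d q \<in> {F. \<forall>n. F $ n \<in> B}"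
  unfolding binomial_series_def
  using is_subring_fps[OF assms(1)] fps_const_in[OF assms] fps_X_power_in[OF assms(1), of d]
  by (intro subring_diff subring_mult subring_one)

text \<open>
  Each new factor \<open>1 - q t\<^bsup>M+1\<^esup>\<close> adjusts the coefficient of \<open>t\<^bsup>M+1\<^esup>\<close> without disturbing the earlier ones.
\<close>

lemma fps_eq_prod_binomial_series:
  assumes B: "is_subring B" and F: "F $ 0 = 1" "\<And>n. F $ n \<in> B"
  shows "\<exists>q. (\<forall>d. q d \<in> B) \<and> (\<forall>k\<le>M. (\<Prod>d = 1..M. binomial_series d (q d)) $ k = F $ k)"
proof (induction M)
  case 0
  show ?case using F subring_zero[OF B] by (intro exI[of _ "\<lambda>_. 0"]) simp
next
  case (Suc M)
  then obtain q where q: "\<And>d. q d \<in> B"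
    "\<And>k. k \<le> M \<Longrightarrow> (\<Prod>d = 1..M. binomial_series d (q d)) $ k = F $ k"
    by blast
  define P where "P = (\<Prod>d = 1..M. binomial_series d (q d))"
  have "P \<in> {F. \<forall>n. F $ n \<in> B}"
    unfolding P_def by (intro subring_prod is_subring_fps binomial_series_in B q)
  then have PB: "P $ n \<in> B" for n by blast
  define c where "c = P $ Suc M - F $ Suc M"
  let ?q = "q(Suc M := c)"
  have "(\<Prod>d = 1..Suc M. binomial_series d (?q d)) = binomial_series (Suc M) c * P"
    by (simp add: P_def mult.commute)
  moreover have "(binomial_series (Suc M) c * P) $ k = P $ k - (if k < Suc M then 0 else c * P $ (k - Suc M))" for k
    unfolding binomial_series_def left_diff_distrib fps_sub_nth mult_X_power_nth by simp
  moreover have "P $ 0 = 1" using q(2)[of 0] F by (simp add: P_def)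
  ultimately have "(\<Prod>d = 1..Suc M. binomial_series d (?q d)) $ k = F $ k" if "k \<le> Suc M" for k
    using that q(2)[of k, folded P_def] by (cases "k = Suc M") (simp_all add: c_def)
  moreover have "?q d \<in> B" for d
    using q PB F by (auto simp: c_def intro: subring_diff[OF B])
  ultimately show ?case by blast
qed

text \<open>
  The \<open>g\<close>-th powers of the \<open>d\<close>-th roots of \<open>q\<close> are, with \<open>c = gcd d g\<close>, the \<open>d/c\<close>-th roots of \<open>q\<^bsup>g/c\<^esup>\<close>, each
  taken \<open>c\<close> times.
\<close>

lemma binomial_power_sums_multiple:
  assumes "d > 0" "g > 0"
  shows "of_nat (gcd d g) * binomial_power_sums (d div gcd d g) (q ^ (g div gcd d g)) $ k
    = binomial_power_sums d q $ (g * k)"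
proof -
  define c where "c = gcd d g"
  obtain d' g' where eq: "d = d' * c" "g = g' * c" and cop: "coprime d' g'"
    unfolding c_def using assms(1) by (metis gcd_coprime_exists gcd_eq_0_iff less_irrefl)
  have pos: "c > 0" "d' > 0" "g' > 0" using assms eq by auto
  have dvd: "d dvd g * k \<longleftrightarrow> d' dvd k"
    using cop pos by (simp add: eq ac_simps coprime_dvd_mult_right_iff)
  have "g' * (k div d') = g * k div d" if "d' dvd k"
    using that pos by (auto simp: eq elim!: dvdE)
  moreover have "d div c = d'" "g div c = g'" using pos by (simp_all add: eq)
  ultimately show ?thesis
    using assms pos dvd unfolding c_def[symmetric]
    by (auto simp: binomial_power_sums_def eq power_mult[symmetric] mult_ac)
qed

text \<open>
  If \<open>F = \<Prod> (1 - x\<^sub>i t)\<close> and \<open>G = \<Prod> (1 - x\<^sub>i\<^sup>g t)\<close>, then the coefficients of \<open>G\<close> are integer polynomials in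
  those of \<open>F\<close>. Instead of the fundamental theorem of symmetric functions, the proof uses the
  coordinates \<open>q\<^sub>d\<close> with \<open>F = \<Prod> (1 - q\<^sub>d t\<^sup>d)\<close>, in which passing to \<open>g\<close>-th powers is explicit:
  \<open>G = \<Prod> (1 - q\<^sub>d\<^bsup>g/c\<^esup> t\<^bsup>d/c\<^esup>)\<^sup>c\<close> with \<open>c = gcd d g\<close>. Both sides have the same power sums, and without torsion
  these determine a series. For the coefficient of \<open>t\<^sup>n\<close> in \<open>G\<close>, the factors with \<open>d \<le> g n\<close> suffice.
\<close>

theorem series_of_powers_in_subring:
  fixes F G :: "'a::comm_ring_1 fps"
  assumes torsion_free: "\<And>n x::'a. n > 0 \<Longrightarrow> of_nat n * x = 0 \<Longrightarrow> x = 0"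
    and B: "is_subring B" and F: "F $ 0 = 1" "\<And>n. F $ n \<in> B"
    and L: "power_sums F L" and G: "G $ 0 = 1" and M: "power_sums G M" "M $ 0 = 0"
    and LM: "\<And>n. n > 0 \<Longrightarrow> M $ n = L $ (g * n)" and "g > 0"
  shows "G $ n \<in> B"
proof -
  obtain q where q: "\<And>d. q d \<in> B"
    "\<And>k. k \<le> g * n \<Longrightarrow> (\<Prod>d = 1..g * n. binomial_series d (q d)) $ k = F $ k"
    using fps_eq_prod_binomial_series[OF B F, of "g * n"] by blast
  let ?D = "{1..g * n}"
  define P where "P = (\<Prod>d\<in>?D. binomial_series d (q d))"
  define LP where "LP = (\<Sum>d\<in>?D. binomial_power_sums d (q d))"
  define H where "H = (\<Prod>d\<in>?D. binomial_series (d div gcd d g) (q d ^ (g div gcd d g)) ^ gcd d g)"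
  define LH where "LH = (\<Sum>d\<in>?D. of_nat (gcd d g) *
    binomial_power_sums (d div gcd d g) (q d ^ (g div gcd d g)))"
  have P: "power_sums P LP"
    unfolding P_def LP_def by (intro power_sums_prod power_sums_binomial) simp
  have H: "power_sums H LH"
    unfolding H_def LH_def
    by (intro power_sums_prod power_sums_power power_sums_binomial)
      (simp add: div_greater_zero_iff gcd_le1_nat)
  have LH: "LH $ k = LP $ (g * k)" for k
  proof -
    have nat: "(of_nat m * K) $ k = of_nat m * K $ k" for m and K :: "'a fps"
      by (simp flip: fps_of_nat)
    show ?thesis
      unfolding LH_def LP_def fps_sum_nth nat
      using \<open>g > 0\<close> by (intro sum.cong binomial_power_sums_multiple) auto
  qed
  have agree: "M $ k = LH $ k" if "k \<le> n" for k
  proof (cases "k = 0")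
    case False
    have "L $ (g * k) = LP $ (g * k)"
      using L P F(1) by (rule power_sums_determined[where N = "g * n"]) (use q that in \<open>auto simp: P_def\<close>)
    then show ?thesis using LM False LH by simp
  next
    case True
    then show ?thesis using M(2) LH[of 0] by (simp add: LP_def fps_sum_nth binomial_power_sums_def)
  qed
  have "G $ n = H $ n"
  proof (rule determined_by_power_sums[OF M(1) H _ M(2) _ _ order_refl torsion_free])
    show "LH $ 0 = 0" using LH[of 0] by (simp add: LP_def fps_sum_nth binomial_power_sums_def)
    have "(\<Prod>d\<in>D. f d) $ 0 = (\<Prod>d\<in>D. f d $ 0)" for D :: "nat set" and f :: "nat \<Rightarrow> 'a fps"
      by (induction D rule: infinite_finite_induct) simp_all
    moreover have "(f ^ k) $ 0 = (f $ 0) ^ k" for f :: "'a fps" and k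
      by (induction k) simp_all
    moreover have "binomial_series d x $ 0 = 1" if "d > 0" for d and x :: 'a
      using that by (simp add: binomial_series_def fps_X_power_nth)
    ultimately have "H $ 0 = (\<Prod>d\<in>?D. 1)"
      unfolding H_def by (simp only:) (intro prod.cong, auto simp: div_greater_zero_iff gcd_le1_nat)
    then show "G $ 0 = H $ 0" by (simp add: G)
  qed (use agree in auto)
  moreover have "H \<in> {F. \<forall>n. F $ n \<in> B}"
    unfolding H_def by (intro subring_prod subring_power is_subring_fps binomial_series_in B q)
  ultimately show ?thesis by simp
qed

theorem esym_word_power_in_subring:
  assumes B: "is_subring B" and v: "\<And>n. esym v n \<in> B" and g: "g > 0"
  shows "esym (word_power g v) n \<in> B"
proof -
  have neg: "(-1) ^ n \<in> B" for n
    using subring_power[OF B subring_of_int[OF B, of "-1"]] by simp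
  have "esym_series (word_power g v) $ n \<in> B"
  proof (rule series_of_powers_in_subring[OF qsh_torsion_free B])
    show "power_sums (esym_series v) (power_sum_series v)"
      "power_sums (esym_series (word_power g v)) (power_sum_series (word_power g v))"
      by (simp_all only: power_sums_def Newton_identity)
    show "esym_series v $ n \<in> B" for n
      using v neg by (simp add: esym_series_def subring_mult[OF B])
    show "power_sum_series (word_power g v) $ n = power_sum_series v $ (g * n)" if "n > 0" for n
      using that g by (simp add: power_sum_series_def letter_power_mult comp_def mult.commute)
  qed (simp_all add: esym_series_def power_sum_series_def g)
  then have "(-1) ^ n * ((-1) ^ n * esym (word_power g v) n) \<in> B"
    using neg by (simp only: esym_series_def fps_nth_Abs_fps subring_mult[OF B])
  moreover have "(-1) ^ n * ((-1) ^ n * f) = f" for f :: "'a free_semigroup qsh"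
    by (simp flip: mult.assoc power_mult_distrib)
  ultimately show ?thesis by simp
qed

section \<open>Leading words of the elementary symmetric functions\<close>

lemma coeff_word_mult: "coeff (word u * word v) z = Poly_Mapping.lookup (mshuffle_words 1 u v) z"
  by (simp add: coeff_def times_qsh.rep_eq word.rep_eq)

lemma coeff_nonzero_iff: "coeff f u \<noteq> 0 \<longleftrightarrow> u \<in> Poly_Mapping.keys (coeffs f)"
  by (simp add: coeff_def in_keys_iff)

lemma qsh_expand: "f = (\<Sum>u\<in>Poly_Mapping.keys (coeffs f). of_int (coeff f u) * word u)"
  by (rule qsh_eqI)
    (simp add: if_distrib[of "\<lambda>x. _ * x"] sum.delta' coeff_nonzero_iff[symmetric] cong: if_cong)

lemma coeff_mult:
  "coeff (f * g) z = (\<Sum>u\<in>Poly_Mapping.keys (coeffs f). \<Sum>v\<in>Poly_Mapping.keys (coeffs g).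
    coeff f u * coeff g v * Poly_Mapping.lookup (mshuffle_words 1 u v) z)"
proof -
  let ?F = "Poly_Mapping.keys (coeffs f)" and ?G = "Poly_Mapping.keys (coeffs g)"
  have "f * g = (\<Sum>u\<in>?F. of_int (coeff f u) * word u) * (\<Sum>v\<in>?G. of_int (coeff g v) * word v)"
    using qsh_expand[of f] qsh_expand[of g] by simp
  also have "\<dots> = (\<Sum>u\<in>?F. \<Sum>v\<in>?G. of_int (coeff f u * coeff g v) * (word u * word v))"
    by (simp add: sum_product mult_ac)
  finally show ?thesis by (simp del: of_int_mult add: coeff_word_mult)
qed

lemma coeff_mult_nonzero:
  assumes "coeff (f * g) z \<noteq> 0"
  obtains u v where "coeff f u \<noteq> 0" "coeff g v \<noteq> 0" "z \<in> Poly_Mapping.keys (mshuffle_words 1 u v)"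
proof -
  from assms obtain u where "(\<Sum>v\<in>Poly_Mapping.keys (coeffs g).
    coeff f u * coeff g v * Poly_Mapping.lookup (mshuffle_words 1 u v) z) \<noteq> 0"
    unfolding coeff_mult by (rule sum.not_neutral_contains_not_neutral)
  then obtain v where "coeff f u * coeff g v * Poly_Mapping.lookup (mshuffle_words 1 u v) z \<noteq> 0"
    by (rule sum.not_neutral_contains_not_neutral)
  then show thesis using that[of u v] by (simp add: in_keys_iff)
qed

text \<open>
  A condition on the support that is stable under products and bounds the words of maximal length by
  \<open>shuffle_of_lyndon_le\<close>.
\<close>

definition shuffle_bounded :: "'s qsh \<Rightarrow> 's list multiset \<Rightarrow> bool"
  where "shuffle_bounded f A \<longleftrightarrow>
    (\<forall>u. coeff f u \<noteq> 0 \<longrightarrow> length u < (\<Sum>l\<in>#A. length l) \<or> shuffle_of A u)"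

lemma shuffle_bounded_length:
  "shuffle_bounded f A \<Longrightarrow> coeff f u \<noteq> 0 \<Longrightarrow> length u \<le> (\<Sum>l\<in>#A. length l)"
  unfolding shuffle_bounded_def by (metis shuffle_of_length less_imp_le_nat order_refl)

lemma shuffle_bounded_word: "shuffle_bounded (word w) {#w#}" for w :: "'s::ab_semigroup_mult list"
  by (auto simp: shuffle_bounded_def shuffle_of_single split: if_splits)

lemma shuffle_bounded_mult:
  assumes f: "shuffle_bounded f A" and g: "shuffle_bounded g B"
  shows "shuffle_bounded (f * g) (A + B)"
  unfolding shuffle_bounded_def
proof (intro allI impI)
  fix z assume "coeff (f * g) z \<noteq> 0"
  then obtain u v where uv: "coeff f u \<noteq> 0" "coeff g v \<noteq> 0"
      "z \<in> Poly_Mapping.keys (mshuffle_words 1 u v)"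
    by (rule coeff_mult_nonzero)
  have "length u \<le> (\<Sum>l\<in>#A. length l)" "length v \<le> (\<Sum>l\<in>#B. length l)"
    using uv f g by (auto intro: shuffle_bounded_length)
  moreover have "length u < (\<Sum>l\<in>#A. length l) \<or> shuffle_of A u"
    "length v < (\<Sum>l\<in>#B. length l) \<or> shuffle_of B v"
    using uv f g by (auto simp: shuffle_bounded_def)
  moreover have "length z < length u + length v \<or> length z = length u + length v \<and> z \<in> shuffles u v"
    using uv(3) by (rule keys_mshuffle_words)
  ultimately show "length z < (\<Sum>l\<in>#A + B. length l) \<or> shuffle_of (A + B) z"
    using shuffle_of_shuffles[of z u v A B] by auto
qed

definition leads :: "'s::linorder qsh \<Rightarrow> 's list multiset \<Rightarrow> bool"
  where "leads f A \<longleftrightarrow> shuffle_bounded f A \<and> coeff f (decr_concat A) = 1"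

lemma leads_word: "leads (word w) (lyndon_factors w)" for w :: "'s::{linorder,ab_semigroup_mult} list"
proof -
  have "shuffle_of (lyndon_factors w) w"
    using shuffle_of_split_factors[of w "{#}" w] shuffle_of_single[of w] by simp
  then show ?thesis by (auto simp: leads_def shuffle_bounded_def split: if_splits)
qed

text \<open>
  The hypothesis that \<open>A\<close> lies above \<open>B\<close> cannot be relaxed to equality: already the square of a
  letter has leading coefficient 2.
\<close>

lemma leads_mult:
  fixes f g :: "'s::{linorder,ab_semigroup_mult} qsh"
  assumes f: "leads f A" and g: "leads g B" and lyn: "all_lyndon A" "all_lyndon B"
    and less: "\<And>x y. x \<in># A \<Longrightarrow> y \<in># B \<Longrightarrow> y < x"
  shows "leads (f * g) (A + B)"
proof -
  let ?F = "Poly_Mapping.keys (coeffs f)" and ?G = "Poly_Mapping.keys (coeffs g)"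
  let ?A = "decr_concat A" and ?B = "decr_concat B"
  have W: "decr_concat (A + B) = ?A @ ?B"
    using less by (intro decr_concat_union) (simp add: less_imp_le)
  have single: "Poly_Mapping.lookup (mshuffle_words 1 u v) (?A @ ?B) = (if u = ?A \<and> v = ?B then 1 else 0)"
    if "u \<in> ?F" "v \<in> ?G" for u v
  proof (cases "shuffle_of A u \<and> shuffle_of B v")
    case True
    then show ?thesis
      using lyn less by (simp add: lookup_mshuffle_words_decr_concat)
  next
    case False
    have "length u \<le> length ?A" "length v \<le> length ?B"
      "\<not> shuffle_of A u \<Longrightarrow> length u < length ?A" "\<not> shuffle_of B v \<Longrightarrow> length v < length ?B"
      using that f g shuffle_bounded_length[of f A u] shuffle_bounded_length[of g B v]
      by (auto simp: leads_def shuffle_bounded_def coeff_nonzero_iff length_decr_concat)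
    then have "length u + length v < length (?A @ ?B)" using False by auto
    then have "?A @ ?B \<notin> Poly_Mapping.keys (mshuffle_words 1 u v)" "\<not> (u = ?A \<and> v = ?B)"
      using keys_mshuffle_words[of "?A @ ?B" 1 u v] by auto
    then show ?thesis by (simp add: in_keys_iff)
  qed
  have "coeff (f * g) (?A @ ?B) =
    (\<Sum>u\<in>?F. \<Sum>v\<in>?G. if v = ?B then if u = ?A then coeff f u * coeff g v else 0 else 0)"
    unfolding coeff_mult by (intro sum.cong refl) (simp add: single)
  also have "\<dots> = coeff f ?A * coeff g ?B"
    using f g by (simp add: leads_def sum.delta coeff_nonzero_iff[symmetric] cong: if_cong)
  finally show ?thesis
    using f g by (simp add: leads_def W shuffle_bounded_mult)
qed

text \<open>
  Each leading word occurs in \<open>f\<close>, so it is bounded by the other one.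
\<close>

lemma leads_unique:
  assumes "leads f A" "leads f B" "all_lyndon A" "all_lyndon B"
  shows "A = B"
proof -
  have le: "length (decr_concat A) < length (decr_concat B) \<or>
      length (decr_concat A) = length (decr_concat B) \<and> decr_concat A \<le> decr_concat B"
    if "leads f A" "leads f B" "all_lyndon B" for A B
  proof -
    have nz: "coeff f (decr_concat A) \<noteq> 0" and "shuffle_bounded f B"
      using that by (simp_all add: leads_def)
    from this(2)[unfolded shuffle_bounded_def, rule_format, OF nz]
    show ?thesis
    proof
      assume "shuffle_of B (decr_concat A)"
      from shuffle_of_length[OF this] shuffle_of_lyndon_le[OF this that(3)]
      show ?thesis by (simp add: length_decr_concat)
    qed (simp add: length_decr_concat)
  qed
  have "decr_concat A = decr_concat B"
    using le[of A B] le[of B A] assms by auto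
  then show ?thesis using assms by (intro Lyndon_factorization_unique)
qed

lemma esym_length: "coeff (esym v n) u \<noteq> 0 \<Longrightarrow> length u \<le> n * length v"
proof (induction v n arbitrary: u rule: esym.induct)
  case (1 n)
  then show ?case by (auto split: if_splits)
next
  case (2 a v n)
  show ?case
  proof (cases "n = 0")
    case True
    with 2 show ?thesis by (auto split: if_splits)
  next
    case False
    with 2(3) obtain j where j: "j \<in> {1..n}"
        "coeff (cons (letter_power j a) (esym (a # v) (n - j) * esym v j)) u \<noteq> 0"
      by (auto simp: esym.simps elim: sum.not_neutral_contains_not_neutral)
    then obtain z where z: "u = letter_power j a # z" "coeff (esym (a # v) (n - j) * esym v j) z \<noteq> 0"
      by (cases u) (auto split: if_splits)
    from z(2) obtain x y where xy: "coeff (esym (a # v) (n - j)) x \<noteq> 0" "coeff (esym v j) y \<noteq> 0"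
        "z \<in> Poly_Mapping.keys (mshuffle_words 1 x y)"
      by (rule coeff_mult_nonzero)
    have "length x \<le> (n - j) * length (a # v)" "length y \<le> j * length v"
      using 2(1)[OF False j(1)] 2(2)[OF False j(1)] xy by auto
    moreover have "length z \<le> length x + length y"
      using keys_mshuffle_words[OF xy(3)] by auto
    moreover obtain m where "n = m + j" using j(1) by (metis atLeastAtMost_iff le_add_diff_inverse2)
    ultimately show ?thesis using z(1) j(1) by (simp add: algebra_simps)
  qed
qed

lemma esym_1: "esym v (Suc 0) = word v"
  by (induction v) (simp_all add: esym.simps word_Nil word_Cons)

lemma decr_concat_replicate_Suc:
  "decr_concat (replicate_mset (Suc n) v) = v @ decr_concat (replicate_mset n v)"
  unfolding replicate_mset_Suc by (rule decr_concat_add_max) (simp split: if_splits)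

lemma all_lyndon_replicate: "lyndon v \<Longrightarrow> all_lyndon (replicate_mset n v)"
  by (induction n) simp_all

text \<open>
  In the recursion for \<open>v = a \<otimes> q\<close>, the terms with \<open>j \<ge> 2\<close> are too short. The term with \<open>j = 1\<close> is \<open>a\<close> in front
  of the product of \<open>q\<close> and \<open>e\<^sub>n(v)\<close>, and the Lyndon factors of \<open>q\<close> are larger than \<open>v\<close>, so that the leading word of
  this product is \<open>q\<close> followed by \<open>n\<close> copies of \<open>v\<close>.
\<close>

lemma leads_esym:
  assumes v: "lyndon v"
  shows "leads (esym v n) (replicate_mset n v)"
proof (induction n)
  case 0
  show ?case by (auto simp: leads_def shuffle_bounded_def shuffle_of.empty split: if_splits)
next
  case (Suc n)
  let ?M = "replicate_mset n v"
  obtain a q where aq: "v = a # q" using lyndon_nonempty[OF v] by (cases v) auto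
  let ?t = "\<lambda>j. esym v (Suc n - j) * esym q j"
  have e: "esym v (Suc n) = (\<Sum>j = 1..Suc n. cons (letter_power j a) (?t j))"
    by (simp add: aq esym.simps del: sum.cl_ivl_Suc)
  have len: "length z + j \<le> Suc n * length v" if "j \<in> {1..Suc n}" "coeff (?t j) z \<noteq> 0" for j z
  proof -
    from that(2) obtain x y where xy: "coeff (esym v (Suc n - j)) x \<noteq> 0" "coeff (esym q j) y \<noteq> 0"
        "z \<in> Poly_Mapping.keys (mshuffle_words 1 x y)"
      by (rule coeff_mult_nonzero)
    have "length x \<le> (Suc n - j) * length v" "length y \<le> j * length q"
      using esym_length xy by auto
    moreover have "length z \<le> length x + length y"
      using keys_mshuffle_words[OF xy(3)] by auto
    moreover have "(Suc n - j) * length v + j * length v = Suc n * length v"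
      using that(1) by (simp flip: add_mult_distrib)
    ultimately show ?thesis by (simp add: aq)
  qed
  have tot: "(\<Sum>l\<in>#replicate_mset (Suc n) v. length l) = Suc n * length v"
    by (simp del: replicate_mset_Suc)
  have "shuffle_bounded (esym v (Suc n)) (replicate_mset (Suc n) v)"
    unfolding shuffle_bounded_def tot
  proof (intro allI impI)
    fix u assume "coeff (esym v (Suc n)) u \<noteq> 0"
    then obtain j where j: "j \<in> {1..Suc n}" "coeff (cons (letter_power j a) (?t j)) u \<noteq> 0"
      unfolding e coeff_sum by (rule sum.not_neutral_contains_not_neutral)
    then obtain z where z: "u = letter_power j a # z" "coeff (?t j) z \<noteq> 0"
      by (cases u) (auto split: if_splits)
    show "length u < Suc n * length v \<or> shuffle_of (replicate_mset (Suc n) v) u"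
    proof (cases "j = 1")
      case True
      then have "coeff (word q * esym v n) z \<noteq> 0" using z by (simp add: esym_1 mult.commute)
      moreover have "shuffle_bounded (word q * esym v n) ({#q#} + ?M)"
        using Suc by (intro shuffle_bounded_mult shuffle_bounded_word) (simp add: leads_def)
      ultimately have "length z < length q + n * length v \<or> shuffle_of (add_mset q ?M) z"
        by (auto simp: shuffle_bounded_def)
      then show ?thesis using z(1) True by (auto simp: aq intro: shuffle_of.step)
    next
      case False
      with len[OF j(1) z(2)] j(1) z(1) show ?thesis by simp
    qed
  qed
  moreover have "coeff (esym v (Suc n)) (decr_concat (replicate_mset (Suc n) v)) = 1"
  proof -
    let ?W = "q @ decr_concat ?M"
    have lenW: "length ?W + 1 = Suc n * length v"
      by (simp add: aq length_decr_concat)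
    have "leads (word q * esym v n) (lyndon_factors q + ?M)"
      using Suc v by (intro leads_mult leads_word) (auto simp: aq all_lyndon_replicate dest: factors_of_lyndon_suffix split: if_splits)
    moreover have "decr_concat (lyndon_factors q + ?M) = ?W"
    proof -
      have "y \<le> x" if "x \<in># lyndon_factors q" "y \<in># ?M" for x y
        using that factors_of_lyndon_suffix[of a q x] v by (auto simp: aq split: if_splits)
      then have "decr_concat (lyndon_factors q + ?M) = decr_concat (lyndon_factors q) @ decr_concat ?M"
        by (rule decr_concat_union)
      then show ?thesis by simp
    qed
    ultimately have one: "coeff (?t 1) ?W = 1" by (simp add: leads_def esym_1 mult.commute)
    have "coeff (esym v (Suc n)) (a # ?W) =
      (\<Sum>j = 1..Suc n. if j = 1 then coeff (?t 1) ?W else 0)"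
      unfolding e coeff_sum
    proof (intro sum.cong refl)
      fix j assume j: "j \<in> {1..Suc n}"
      have "coeff (?t j) ?W = 0" if "j \<noteq> 1"
        using len[OF j, of ?W] lenW that j by fastforce
      then show "coeff (cons (letter_power j a) (?t j)) (a # ?W) = (if j = 1 then coeff (?t 1) ?W else 0)"
        by auto
    qed
    also have "\<dots> = 1" using one by (simp del: sum.cl_ivl_Suc)
    finally show ?thesis by (simp add: decr_concat_replicate_Suc aq del: replicate_mset_Suc)
  qed
  ultimately show ?case by (simp add: leads_def)
qed

lemma leads_prod_esym:
  assumes "finite S" "\<And>v. v \<in> S \<Longrightarrow> lyndon v"
  shows "leads (\<Prod>v\<in>S. esym v (n v)) (\<Sum>v\<in>S. replicate_mset (n v) v)"
  using assms
proof (induction S rule: finite_linorder_max_induct)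
  case empty
  show ?case by (auto simp: leads_def shuffle_bounded_def shuffle_of.empty split: if_splits)
next
  case (insert b S)
  have sub: "\<exists>v\<in>S. x = v" if "x \<in># (\<Sum>v\<in>S. replicate_mset (n v) v)" for x
    using that insert.hyps(1) by (auto simp: set_mset_sum split: if_splits)
  have "leads (esym b (n b) * (\<Prod>v\<in>S. esym v (n v)))
      (replicate_mset (n b) b + (\<Sum>v\<in>S. replicate_mset (n v) v))"
    using insert sub
    by (intro leads_mult leads_esym all_lyndon_replicate) (auto simp: all_lyndon_def split: if_splits)
  moreover have "b \<notin> S" using insert.hyps by auto
  ultimately show ?case using insert.hyps by simp
qed

section \<open>Homogeneity\<close>

definition homog :: "'x free_semigroup qsh \<Rightarrow> nat \<Rightarrow> bool"
  where "homog f n \<longleftrightarrow> (\<forall>u. coeff f u \<noteq> 0 \<longrightarrow> word_deg u = n)"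

lemma homog_one: "homog 1 0"
  by (simp add: homog_def)

lemma homog_mult: "homog f m \<Longrightarrow> homog g n \<Longrightarrow> homog (f * g) (m + n)"
  unfolding homog_def
  by (metis coeff_mult_nonzero word_deg_mshuffle_words)

lemma homog_prod: "(\<And>i. i \<in> I \<Longrightarrow> homog (f i) (d i)) \<Longrightarrow> homog (\<Prod>i\<in>I. f i) (\<Sum>i\<in>I. d i)"
  by (induction I rule: infinite_finite_induct) (simp_all add: homog_one homog_mult)

lemma homog_power: "homog f d \<Longrightarrow> homog (f ^ n) (n * d)"
  by (induction n) (simp_all add: homog_one homog_mult)

lemma homog_esym: "homog (esym v n) (n * word_deg v)"
proof (induction v n rule: esym.induct)
  case (1 n)
  then show ?case by (auto simp: homog_def)
next
  case (2 a v n)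
  show ?case
  proof (cases "n = 0")
    case False
    show ?thesis
      unfolding homog_def
    proof (intro allI impI)
      fix u assume "coeff (esym (a # v) n) u \<noteq> 0"
      with False obtain j where j: "j \<in> {1..n}"
          "coeff (cons (letter_power j a) (esym (a # v) (n - j) * esym v j)) u \<noteq> 0"
        by (auto simp: esym.simps elim: sum.not_neutral_contains_not_neutral)
      then obtain z where z: "u = letter_power j a # z" "coeff (esym (a # v) (n - j) * esym v j) z \<noteq> 0"
        by (cases u) (auto split: if_splits)
      have "word_deg z = (n - j) * word_deg (a # v) + j * word_deg v"
        using homog_mult[OF 2(1)[OF False j(1)] 2(2)[OF False j(1)]] z(2) by (simp add: homog_def)
      moreover have "(n - j) * word_deg (a # v) + j * word_deg (a # v) = n * word_deg (a # v)"
        using j(1) by (simp flip: add_mult_distrib)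
      moreover have "deg (letter_power j a) = j * deg a" using j(1) by (simp add: deg_letter_power)
      ultimately show "word_deg u = n * word_deg (a # v)" by (simp add: z(1) add_mult_distrib2)
    qed
  qed (simp add: homog_one)
qed

section \<open>The elementary symmetric functions of Lyndon words generate\<close>

lemma deg_pos: "deg a > 0"
  by transfer (simp add: nonempty_has_size)

lemma length_le_word_deg: "length w \<le> word_deg w"
proof (induction w)
  case (Cons a w)
  then show ?case using deg_pos[of a] by simp
qed simp

lemma finite_words: "finite {w :: 'x::finite free_semigroup list. word_deg w \<le> d}"
proof -
  let ?L = "{a :: 'x free_semigroup. deg a \<le> d}"
  have "mset_of ` ?L \<subseteq> mset ` {xs. set xs \<subseteq> UNIV \<and> length xs \<le> d}"
  proof
    fix m assume "m \<in> mset_of ` ?L"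
    then have "size m \<le> d" by (auto simp: deg.rep_eq)
    moreover obtain xs where "m = mset xs" by (metis ex_mset)
    ultimately show "m \<in> mset ` {xs. set xs \<subseteq> UNIV \<and> length xs \<le> d}" by auto
  qed
  then have "finite (mset_of ` ?L)"
    by (rule finite_subset) (intro finite_imageI finite_lists_length_le finite)
  then have "finite ?L"
    by (rule finite_imageD) (auto simp: inj_on_def mset_of_inject)
  then have "finite {w. set w \<subseteq> ?L \<and> length w \<le> d}" by (rule finite_lists_length_le)
  moreover have "{w :: 'x free_semigroup list. word_deg w \<le> d} \<subseteq> {w. set w \<subseteq> ?L \<and> length w \<le> d}"
  proof clarify
    fix w :: "'x free_semigroup list" assume w: "word_deg w \<le> d"
    have "deg a \<le> word_deg w" if "a \<in> set w" for a
      using that by (induction w) auto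
    with w length_le_word_deg[of w] show "set w \<subseteq> ?L \<and> length w \<le> d" by fastforce
  qed
  ultimately show ?thesis by (rule rev_finite_subset)
qed

lemma sum_mset_eq_sum_count: "(\<Sum>x\<in>#M. f x) = (\<Sum>x\<in>set_mset M. count M x * f x)" for f :: "'a \<Rightarrow> nat"
proof -
  have "(\<Sum>x\<in>#M. f x) = (\<Sum>x\<in>S. count M x * f x)" if "finite S" "set_mset M \<subseteq> S" for S
    using that(2)
  proof (induction M)
    case (add y M)
    have "(\<Sum>x\<in>S. count (add_mset y M) x * f x) = (\<Sum>x\<in>S. (if x = y then f x else 0) + count M x * f x)"
      by (intro sum.cong) auto
    with add that(1) show ?case by (simp add: sum.distrib)
  qed simp
  then show ?thesis by simp
qed

text \<open>
  The terms that can accompany a leading word \<open>w\<close>. There are finitely many, and their number serves as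
  the measure for an induction on leading words.
\<close>

definition smaller_words :: "'x::linorder free_semigroup list \<Rightarrow> 'x free_semigroup list set"
  where "smaller_words w = {u. word_deg u = word_deg w \<and>
    (length u < length w \<or> length u = length w \<and> u < w)}"

lemma card_smaller_words:
  fixes u w :: "'x::{finite,linorder} free_semigroup list"
  assumes "u \<in> smaller_words w"
  shows "card (smaller_words u) < card (smaller_words w)"
proof (rule psubset_card_mono)
  show "finite (smaller_words w)"
    by (rule finite_subset[OF _ finite_words[of "word_deg w"]]) (auto simp: smaller_words_def)
  show "smaller_words u \<subset> smaller_words w"
    using assms by (auto simp: smaller_words_def)
qed

text \<open>
  Subtracting from \<open>w\<close> the product of elementary symmetric functions with leading word \<open>w\<close> leaves smaller words
  of the same degree.
\<close>

lemma Lyndon_esym_generate: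
  fixes B :: "'x::{finite,linorder} free_semigroup qsh set"
  assumes B: "is_subring B" and esym: "\<And>v n. lyndon v \<Longrightarrow> esym v n \<in> B"
  shows "f \<in> B"
proof -
  have word: "word w \<in> B" for w
  proof (induction "card (smaller_words w)" arbitrary: w rule: less_induct)
    case less
    define M where "M = lyndon_factors w"
    define P where "P = (\<Prod>v\<in>set_mset M. esym v (count M v))"
    have lyn: "all_lyndon M" "decr_concat M = w" by (simp_all add: M_def)
    have M: "(\<Sum>v\<in>set_mset M. replicate_mset (count M v) v) = M"
      by (rule multiset_eqI) (simp add: count_sum if_distrib sum.delta not_in_iff cong: if_cong)
    have "leads P M"
      using leads_prod_esym[of "set_mset M" "count M"] lyn(1) unfolding M P_def by (simp add: all_lyndon_def)
    have "homog P (\<Sum>v\<in>set_mset M. count M v * word_deg v)"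
      unfolding P_def by (intro homog_prod homog_esym)
    moreover have "(\<Sum>v\<in>set_mset M. count M v * word_deg v) = word_deg w"
      by (simp add: word_deg_decr_concat sum_mset_eq_sum_count flip: lyn(2))
    ultimately have hom: "homog P (word_deg w)" by simp
    have small: "word u \<in> B" if "coeff P u \<noteq> 0" "u \<noteq> w" for u
    proof (rule less)
      have "length u < length w \<or> shuffle_of M u"
        using \<open>leads P M\<close> that by (auto simp: leads_def shuffle_bounded_def lyn(2) simp flip: length_decr_concat)
      then have "length u < length w \<or> length u = length w \<and> u < w"
        using shuffle_of_lyndon_le[of M u] shuffle_of_length[of M u] lyn that(2)
        by (auto simp flip: length_decr_concat)
      with hom that show "card (smaller_words u) < card (smaller_words w)"
        by (intro card_smaller_words) (simp add: smaller_words_def homog_def)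
    qed
    have w: "coeff P w = 1" using \<open>leads P M\<close> by (simp add: leads_def lyn)
    have "P = of_int (coeff P w) * word w
        + (\<Sum>u\<in>Poly_Mapping.keys (coeffs P) - {w}. of_int (coeff P u) * word u)"
      using w by (subst qsh_expand[of P], subst sum.remove[of _ w])
        (auto simp: coeff_nonzero_iff[symmetric])
    then have "word w = P - (\<Sum>u\<in>Poly_Mapping.keys (coeffs P) - {w}. of_int (coeff P u) * word u)"
      unfolding w of_int_1 mult_1_left eq_diff_eq by (rule sym)
    moreover have "P \<in> B" unfolding P_def using lyn(1)
      by (intro subring_prod[OF B] esym) (simp add: all_lyndon_def)
    moreover have "(\<Sum>u\<in>Poly_Mapping.keys (coeffs P) - {w}. of_int (coeff P u) * word u) \<in> B"
      using small by (intro subring_sum[OF B] subring_mult[OF B] subring_of_int[OF B])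
        (simp add: coeff_nonzero_iff[symmetric])
    ultimately show ?case using subring_diff[OF B] by metis
  qed
  show ?thesis
    by (subst qsh_expand) (intro subring_sum[OF B] subring_mult[OF B] subring_of_int[OF B] word)
qed

section \<open>Powers of Lyndon words\<close>

lemma map_less_map_iff:
  fixes f :: "'a::linorder \<Rightarrow> 'b::linorder"
  assumes "strict_mono f"
  shows "map f u < map f v \<longleftrightarrow> u < v"
proof (induction u arbitrary: v)
  case Nil
  then show ?case by (cases v) auto
next
  case (Cons a u)
  then show ?case
    using strict_mono_less[OF assms] strict_mono_eq[OF assms] by (cases v) auto
qed

lemma lyndon_map_iff:
  assumes "strict_mono f"
  shows "lyndon (map f w) \<longleftrightarrow> lyndon w"
proof
  assume l: "lyndon (map f w)"
  show "lyndon w"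
    unfolding lyndon_iff
  proof (intro conjI allI impI)
    show "w \<noteq> []" using lyndon_nonempty[OF l] by simp
    fix u v assume "w = u @ v" "u \<noteq> []" "v \<noteq> []"
    then have "map f w < map f v" using lyndon_less_suffix[of "map f u" "map f v"] l by simp
    then show "w < v" by (simp only: map_less_map_iff[OF assms])
  qed
next
  assume l: "lyndon w"
  show "lyndon (map f w)"
    unfolding lyndon_iff
  proof (intro conjI allI impI)
    show "map f w \<noteq> []" using lyndon_nonempty[OF l] by simp
    fix x y assume "map f w = x @ y" "x \<noteq> []" "y \<noteq> []"
    then obtain u v where "w = u @ v" "x = map f u" "y = map f v"
      by (auto simp: map_eq_append_conv)
    moreover from this have "w < v"
      using lyndon_less_suffix[of u v] l \<open>x \<noteq> []\<close> \<open>y \<noteq> []\<close> by simp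
    ultimately show "map f w < y" by (simp only: map_less_map_iff[OF assms])
  qed
qed

lemma sorted_concat_replicate:
  "sorted xs \<Longrightarrow> sorted (concat (map (replicate n) xs))"
  by (induction xs) (auto simp: sorted_append)

lemma mset_concat_replicate: "mset (concat (map (replicate n) xs)) = repeat_mset n (mset xs)"
  by (induction xs) simp_all

lemma generators_letter_power:
  assumes "n > 0"
  shows "generators (letter_power n a) = concat (map (replicate n) (generators a))"
  using assms
proof transfer
  fix n :: nat and m :: "'a multiset"
  let ?xs = "concat (map (replicate n) (sorted_list_of_multiset m))"
  assume "n > 0"
  have "sorted_list_of_multiset (repeat_mset n m) = sorted_list_of_multiset (mset ?xs)"
    by (simp add: mset_concat_replicate)
  also have "\<dots> = ?xs"
    unfolding sorted_list_of_multiset_mset by (intro sorted_sort_id sorted_concat_replicate) simp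
  finally show "sorted_list_of_multiset (if n = 0 then m else repeat_mset n m) = ?xs"
    using \<open>n > 0\<close> by simp
qed

lemma concat_replicate_less:
  fixes xs ys :: "'a::linorder list"
  assumes "n > 0" "length xs = length ys" "xs < ys"
  shows "concat (map (replicate n) xs) < concat (map (replicate n) ys)"
  using assms(2,3)
proof (induction xs ys rule: list_induct2)
  case (Cons x xs y ys)
  obtain k where "n = Suc k" using assms(1) by (cases n) auto
  with Cons show ?case by auto
qed simp

lemma length_generators: "length (generators a) = deg a"
  by transfer (metis mset_sorted_list_of_multiset size_mset)

lemma strict_mono_letter_power:
  assumes "n > 0"
  shows "strict_mono (letter_power n :: 'x::linorder free_semigroup \<Rightarrow> _)"
proof (rule strict_monoI)
  fix a b :: "'x free_semigroup" assume ab: "a < b"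
  show "letter_power n a < letter_power n b"
  proof (cases "deg a = deg b")
    case True
    with ab have "generators a < generators b" by (simp add: less_free_semigroup_def list_less_def)
    then have "generators (letter_power n a) < generators (letter_power n b)"
      using assms True by (simp add: generators_letter_power concat_replicate_less length_generators)
    then show ?thesis
      using assms True by (simp add: less_free_semigroup_def list_less_def deg_letter_power)
  next
    case False
    with ab have "deg a < deg b" by (simp add: less_free_semigroup_def)
    then show ?thesis using assms by (simp add: less_free_semigroup_def deg_letter_power)
  qed
qed

lemma lyndon_word_power_iff: "n > 0 \<Longrightarrow> lyndon (word_power n w) \<longleftrightarrow> lyndon w"
  by (simp add: lyndon_map_iff strict_mono_letter_power)

text \<open>
  The words in which the exponents of all generators in all letters have greatest common divisor 1.
\<close>

definition power_free :: "'x free_semigroup list \<Rightarrow> bool"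
  where "power_free v \<longleftrightarrow> (\<forall>u g. v = word_power g u \<longrightarrow> g \<le> 1)"

lemma word_power_word_power:
  "m > 0 \<Longrightarrow> n > 0 \<Longrightarrow> word_power m (word_power n w) = word_power (m * n) w"
  by (simp add: comp_def letter_power_mult)

lemma lyndon_eq_word_power:
  assumes "lyndon w"
  shows "\<exists>v g. g > 0 \<and> lyndon v \<and> power_free v \<and> w = word_power g v"
  using assms
proof (induction "word_deg w" arbitrary: w rule: less_induct)
  case less
  show ?case
  proof (cases "power_free w")
    case True
    with less.prems show ?thesis by (intro exI[of _ w] exI[of _ 1]) (simp add: map_idI)
  next
    case False
    then obtain u g where u: "w = word_power g u" "g > 1" by (auto simp: power_free_def not_le)
    with less.prems have "lyndon u" by (simp add: lyndon_word_power_iff)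
    have "word_deg u > 0"
      using lyndon_nonempty[OF \<open>lyndon u\<close>] length_le_word_deg[of u] by (cases u) auto
    with u have "word_deg u < word_deg w" by (simp add: word_deg_word_power)
    from less.hyps[OF this \<open>lyndon u\<close>] obtain v h
      where v: "h > 0" "lyndon v" "power_free v" "u = word_power h v" by blast
    with u show ?thesis
      by (intro exI[of _ v] exI[of _ "g * h"]) (simp add: word_power_word_power[symmetric] del: map_map)
  qed
qed

lemma letter_root_exists:
  assumes "n > 0" "\<And>x. n dvd count (mset_of a) x"
  shows "\<exists>b. a = letter_power n b"
proof -
  define m where "m = (\<Sum>x\<in>set_mset (mset_of a). replicate_mset (count (mset_of a) x div n) x)"
  have "count m x = count (mset_of a) x div n" for x
    by (simp add: m_def count_sum if_distrib sum.delta not_in_iff cong: if_cong)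
  then have eq: "mset_of a = repeat_mset n m"
    using assms(2) by (intro multiset_eqI) simp
  then have "m \<noteq> {#}" using mset_of[of a] by auto
  then have "mset_of (letter_power n (Abs_free_semigroup m)) = mset_of a"
    using assms(1) eq by (simp add: mset_of_letter_power Abs_free_semigroup_inverse)
  then show ?thesis by (metis mset_of_inject)
qed

lemma word_root_exists:
  assumes "n > 0" "\<And>a x. a \<in> set v \<Longrightarrow> n dvd count (mset_of a) x"
  shows "\<exists>u. v = word_power n u"
  using assms(2)
proof (induction v)
  case (Cons a v)
  then obtain u where "v = word_power n u" by auto
  moreover obtain b where "a = letter_power n b" using letter_root_exists[OF assms(1)] Cons by force
  ultimately show ?case by (intro exI[of _ "b # u"]) simp
qed simp

text \<open>
  Let \<open>i' = i / gcd i j\<close>. All exponents in \<open>v\<close> are divisible by \<open>i'\<close>, so \<open>v\<close> is an \<open>i'\<close>-th power and \<open>i' = 1\<close>.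
\<close>

lemma word_power_eq_divides:
  assumes "i > 0" "j > 0" and free: "power_free v" and eq: "word_power i u = word_power j v"
  shows "i dvd j"
proof -
  define d where "d = gcd i j"
  define i' where "i' = i div d"
  define j' where "j' = j div d"
  have ij: "i = d * i'" "j = d * j'" by (simp_all add: i'_def j'_def d_def)
  have cop: "coprime i' j'"
    unfolding i'_def j'_def d_def using assms(1) by (intro div_gcd_coprime) simp
  have "i' > 0" "d > 0" using assms(1) by (auto simp: ij(1))
  have len: "length u = length v" using eq by (metis length_map)
  have "i' dvd count (mset_of a) x" if "a \<in> set v" for a x
  proof -
    obtain k where k: "k < length v" "a = v ! k" using \<open>a \<in> set v\<close> by (metis in_set_conv_nth)
    then have "letter_power i (u ! k) = letter_power j a" using eq len by (metis nth_map)
    then have "i * count (mset_of (u ! k)) x = j * count (mset_of a) x"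
      using assms(1,2) mset_of_letter_power by (metis count_repeat_mset)
    then have "i' * count (mset_of (u ! k)) x = j' * count (mset_of a) x"
      using \<open>d > 0\<close> by (simp add: ij mult.assoc)
    then have "i' dvd j' * count (mset_of a) x" by (metis dvd_triv_left)
    then show ?thesis using cop by (simp add: coprime_dvd_mult_right_iff)
  qed
  then obtain w where "v = word_power i' w" using word_root_exists[OF \<open>i' > 0\<close>] by blast
  then have "i' \<le> 1" using free by (auto simp: power_free_def)
  then have "i' = 1" using \<open>i' > 0\<close> by simp
  then show ?thesis by (simp add: ij)
qed

lemma word_power_unique:
  fixes u v :: "'x::linorder free_semigroup list"
  assumes "i > 0" "j > 0" "power_free u" "power_free v" "word_power i u = word_power j v"
  shows "u = v \<and> i = j"
proof -
  have "i dvd j" "j dvd i" using assms word_power_eq_divides by metis+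
  then have "i = j" by (rule dvd_antisym)
  moreover have "inj (letter_power j :: 'x free_semigroup \<Rightarrow> _)"
    using strict_mono_letter_power[OF assms(2)] by (rule strict_mono_imp_inj_on)
  ultimately show ?thesis using assms(5) by (simp add: inj_map_eq_map)
qed

text \<open>
  The pair \<open>(v, j)\<close> stands for the generator \<open>e\<^sub>j(v)\<close> and for the Lyndon word that is the \<open>j\<close>-th power of \<open>v\<close>.
\<close>

definition generator_index :: "('x::linorder free_semigroup list \<times> nat) set"
  where "generator_index = {(v, j). lyndon v \<and> power_free v \<and> j > 0}"

lemma inj_on_word_power: "inj_on (\<lambda>(v, j). word_power j v) generator_index"
  by (auto simp: inj_on_def generator_index_def dest: word_power_unique)

lemma bij_betw_generator_index_Lyn:
  "bij_betw (\<lambda>(v, j). word_power j v) {(v, j) \<in> generator_index. j * word_deg v = n}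
    (Lyn n :: 'x::linorder free_semigroup list set)"
  unfolding bij_betw_def
proof
  show "inj_on (\<lambda>(v, j). word_power j v) {(v, j) \<in> generator_index. j * word_deg v = n}"
    by (rule inj_on_subset[OF inj_on_word_power]) auto
  have "w \<in> (\<lambda>(v, j). word_power j v) ` {(v, j) \<in> generator_index. j * word_deg v = n}"
    if "w \<in> Lyn n" for w :: "'x free_semigroup list"
  proof -
    from that have w: "lyndon w" "word_deg w = n" by (simp_all add: Lyn_def)
    from lyndon_eq_word_power[OF w(1)] obtain v g
      where "g > 0" "lyndon v" "power_free v" "w = word_power g v" by blast
    with w(2) show ?thesis
      by (intro image_eqI[of _ _ "(v, g)"]) (simp_all add: generator_index_def word_deg_word_power)
  qed
  then show "(\<lambda>(v, j). word_power j v) ` {(v, j) \<in> generator_index. j * word_deg v = n}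
      = (Lyn n :: 'x free_semigroup list set)"
    by (auto simp: generator_index_def Lyn_def lyndon_word_power_iff word_deg_word_power)
qed

text \<open>
  The leading word of \<open>e\<^sub>j(v)\<close> is \<open>v\<close> repeated \<open>j\<close> times, from which unique factorization recovers \<open>v\<close> and \<open>j\<close>.
\<close>

lemma inj_on_esym: "inj_on (\<lambda>(v, j). esym v j) (generator_index :: ('x::linorder free_semigroup list \<times> nat) set)"
proof (rule inj_onI)
  fix g h :: "'x free_semigroup list \<times> nat"
  assume *: "g \<in> generator_index" "h \<in> generator_index" "(case g of (v, j) \<Rightarrow> esym v j) = (case h of (v, j) \<Rightarrow> esym v j)"
  obtain v j u i where gh: "g = (v, j)" "h = (u, i)" by (cases g, cases h)
  with * have gens: "(v, j) \<in> generator_index" "(u, i) \<in> generator_index" and eq: "esym v j = esym u i" by simp_all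
  then have lyn: "lyndon v" "lyndon u" and pos: "j > 0" "i > 0" by (simp_all add: generator_index_def)
  have "replicate_mset j v = replicate_mset i u"
    using leads_esym[OF lyn(1), of j] leads_esym[OF lyn(2), of i] lyn unfolding eq
    by (intro leads_unique all_lyndon_replicate)
  with pos show "g = h"
    unfolding gh by (metis in_replicate_mset size_replicate_mset)
qed

lemma esym_generate:
  fixes B :: "'x::{finite,linorder} free_semigroup qsh set"
  assumes B: "is_subring B" and gens: "\<And>v j. (v, j) \<in> generator_index \<Longrightarrow> esym v j \<in> B"
  shows "f \<in> B"
proof (rule Lyndon_esym_generate[OF B])
  fix w :: "'x free_semigroup list" and n assume "lyndon w"
  from lyndon_eq_word_power[OF this] obtain v g
    where v: "g > 0" "lyndon v" "power_free v" "w = word_power g v" by blast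
  have "esym v j \<in> B" for j
    using gens[of v j] v subring_one[OF B] by (cases "j = 0") (auto simp: generator_index_def)
  with B v show "esym w n \<in> B" by (auto intro: esym_word_power_in_subring)
qed

section \<open>Surjective maps between free modules of the same rank\<close>

lemma lookup_sum_frag:
  "finite X \<Longrightarrow> Poly_Mapping.lookup (\<Sum>x\<in>X. frag_cmul (h x) (frag_of x)) y = (if y \<in> X then h y else 0)"
  by (simp add: lookup_sum if_distrib sum.delta cong: if_cong)

text \<open>
  Modulo every \<open>n > 0\<close>, \<open>\<phi>\<close> induces a surjection from the finite set \<open>(\<int>/n)\<^sup>X\<close> to the finite set \<open>(\<int>/n)\<^sup>Y\<close>,
  which is at least as large, so it is a bijection. Hence the coefficients of an element of the kernel are
  divisible by every \<open>n\<close>.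
\<close>

lemma surjective_imp_injective:
  fixes \<phi> :: "('a \<Rightarrow>\<^sub>0 int) \<Rightarrow> ('b \<Rightarrow>\<^sub>0 int)"
  assumes "finite X" "finite Y" "card X \<le> card Y"
    and add: "\<And>p q. \<phi> (p + q) = \<phi> p + \<phi> q"
    and surj: "\<And>q. Poly_Mapping.keys q \<subseteq> Y \<Longrightarrow> \<exists>p. Poly_Mapping.keys p \<subseteq> X \<and> \<phi> p = q"
    and p: "Poly_Mapping.keys p \<subseteq> X" "\<phi> p = 0"
  shows "p = 0"
proof -
  have cmul: "\<phi> (frag_cmul (int n) r) = frag_cmul (int n) (\<phi> r)" for n r
  proof (induction n)
    case 0
    show ?case using add[of 0 0] by simp
  qed (simp add: frag_cmul_distrib add)
  have dvd: "int n dvd Poly_Mapping.lookup p x" if "n > 0" "x \<in> X" for n x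
  proof -
    define D where "D = {0..<int n}"
    define emb where "emb = (\<lambda>h :: 'a \<Rightarrow> int. \<Sum>x\<in>X. frag_cmul (h x) (frag_of x))"
    define red where "red = (\<lambda>r. \<lambda>x\<in>X. Poly_Mapping.lookup r x mod int n)"
    define \<psi> where "\<psi> = (\<lambda>h. \<lambda>y\<in>Y. Poly_Mapping.lookup (\<phi> (emb h)) y mod int n)"
    have red_in: "red r \<in> X \<rightarrow>\<^sub>E D" for r
      using that(1) by (auto simp: red_def D_def)
    \<comment> \<open>Reducing the argument modulo \<open>n\<close> changes the value of \<open>\<phi>\<close> by a multiple of \<open>n\<close>.\<close>
    have \<psi>_red: "\<psi> (red r) = (\<lambda>y\<in>Y. Poly_Mapping.lookup (\<phi> r) y mod int n)"
      if "Poly_Mapping.keys r \<subseteq> X" for r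
    proof -
      define s where "s = (\<Sum>x\<in>X. frag_cmul (Poly_Mapping.lookup r x div int n) (frag_of x))"
      have "r = emb (red r) + frag_cmul (int n) s"
      proof (rule poly_mapping_eqI)
        fix x
        have "x \<notin> X \<Longrightarrow> Poly_Mapping.lookup r x = 0" using that by (auto simp: in_keys_iff)
        then show "Poly_Mapping.lookup r x = Poly_Mapping.lookup (emb (red r) + frag_cmul (int n) s) x"
          using assms(1) by (simp add: lookup_add emb_def s_def red_def lookup_sum_frag)
      qed
      then have "\<phi> r = \<phi> (emb (red r)) + frag_cmul (int n) (\<phi> s)" by (metis add cmul)
      then show ?thesis by (simp add: \<psi>_def lookup_add fun_eq_iff)
    qed
    have fin: "finite (X \<rightarrow>\<^sub>E D)" "finite (Y \<rightarrow>\<^sub>E D)"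
      using assms(1,2) by (auto intro!: finite_PiE simp: D_def)
    have sub: "Y \<rightarrow>\<^sub>E D \<subseteq> \<psi> ` (X \<rightarrow>\<^sub>E D)"
    proof
      fix k assume k: "k \<in> Y \<rightarrow>\<^sub>E D"
      define q where "q = (\<Sum>y\<in>Y. frag_cmul (k y) (frag_of y))"
      have lk: "Poly_Mapping.lookup q y = (if y \<in> Y then k y else 0)" for y
        unfolding q_def by (rule lookup_sum_frag[OF assms(2)])
      then have "Poly_Mapping.keys q \<subseteq> Y" by (auto simp: in_keys_iff split: if_splits)
      then obtain r where r: "Poly_Mapping.keys r \<subseteq> X" "\<phi> r = q" using surj by blast
      have "\<psi> (red r) = k"
        unfolding \<psi>_red[OF r(1)] r(2)
      proof
        fix y
        show "(\<lambda>y\<in>Y. Poly_Mapping.lookup q y mod int n) y = k y"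
          using k lk[of y] by (cases "y \<in> Y") (auto simp: D_def PiE_def Pi_def extensional_def)
      qed
      then show "k \<in> \<psi> ` (X \<rightarrow>\<^sub>E D)" using red_in by (metis imageI)
    qed
    have card: "card (X \<rightarrow>\<^sub>E D) = n ^ card X" "card (Y \<rightarrow>\<^sub>E D) = n ^ card Y"
      using assms(1,2) by (simp_all add: card_PiE D_def)
    have "card (X \<rightarrow>\<^sub>E D) \<le> card (\<psi> ` (X \<rightarrow>\<^sub>E D))"
    proof -
      have "card (X \<rightarrow>\<^sub>E D) \<le> card (Y \<rightarrow>\<^sub>E D)"
        unfolding card using assms(3) that(1) by (intro power_increasing) auto
      also have "\<dots> \<le> card (\<psi> ` (X \<rightarrow>\<^sub>E D))" using fin sub by (intro card_mono) auto
      finally show ?thesis .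
    qed
    then have inj: "inj_on \<psi> (X \<rightarrow>\<^sub>E D)"
      using fin(1) by (intro eq_card_imp_inj_on antisym card_image_le)
    have "\<phi> 0 = 0" using add[of 0 0] by simp
    then have "\<psi> (red p) = \<psi> (red 0)"
      using p by (simp add: \<psi>_red)
    then have "red p = red 0" using inj red_in by (auto dest: inj_onD)
    then have "red p x = red 0 x" by simp
    then show ?thesis using that(2) by (simp add: red_def mod_eq_0_iff_dvd)
  qed
  show ?thesis
  proof (rule poly_mapping_eqI)
    fix x
    let ?c = "Poly_Mapping.lookup p x"
    show "?c = Poly_Mapping.lookup 0 x"
    proof (cases "x \<in> X")
      case True
      have "int (nat \<bar>?c\<bar> + 1) dvd ?c" using dvd[of "nat \<bar>?c\<bar> + 1" x] True by simp
      then have "?c = 0" using zdvd_imp_le[of "int (nat \<bar>?c\<bar> + 1)" "\<bar>?c\<bar>"] by force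
      then show ?thesis by simp
    next
      case False
      then show ?thesis using p by (auto simp: in_keys_iff)
    qed
  qed
qed

section \<open>Evaluation of polynomials\<close>

definition eval_monomial :: "('y \<Rightarrow> 'r::comm_ring_1) \<Rightarrow> ('y \<Rightarrow>\<^sub>0 nat) \<Rightarrow> 'r"
  where "eval_monomial \<theta> m = (\<Prod>y\<in>Poly_Mapping.keys m. \<theta> y ^ Poly_Mapping.lookup m y)"

definition eval_poly :: "('y \<Rightarrow> 'r::comm_ring_1) \<Rightarrow> (('y \<Rightarrow>\<^sub>0 nat) \<Rightarrow>\<^sub>0 int) \<Rightarrow> 'r"
  where "eval_poly \<theta> = lin_ext (eval_monomial \<theta>)"

lemma eval_monomial_superset:
  "finite K \<Longrightarrow> Poly_Mapping.keys m \<subseteq> K \<Longrightarrow> eval_monomial \<theta> m = (\<Prod>y\<in>K. \<theta> y ^ Poly_Mapping.lookup m y)"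
  unfolding eval_monomial_def by (intro prod.mono_neutral_left) (auto simp: in_keys_iff)

lemma eval_monomial_add: "eval_monomial \<theta> (m + n) = eval_monomial \<theta> m * eval_monomial \<theta> n"
proof -
  let ?K = "Poly_Mapping.keys m \<union> Poly_Mapping.keys n"
  have "finite ?K" "Poly_Mapping.keys (m + n) \<subseteq> ?K" "Poly_Mapping.keys m \<subseteq> ?K" "Poly_Mapping.keys n \<subseteq> ?K"
    using keys_add[of m n] by auto
  then show ?thesis
    by (simp add: eval_monomial_superset[where K = ?K] lookup_add power_add prod.distrib)
qed

lemma eval_poly_diff: "eval_poly \<theta> (p - q) = eval_poly \<theta> p - eval_poly \<theta> q"
  and eval_poly_add: "eval_poly \<theta> (p + q) = eval_poly \<theta> p + eval_poly \<theta> q"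
  and eval_poly_zero [simp]: "eval_poly \<theta> 0 = 0"
  and eval_poly_monomial [simp]: "eval_poly \<theta> (frag_of m) = eval_monomial \<theta> m"
  by (simp_all add: eval_poly_def lin_ext_diff lin_ext_add)

lemma eval_poly_one [simp]: "eval_poly \<theta> 1 = 1"
  using eval_poly_monomial[of \<theta> 0] by (simp add: eval_monomial_def)

lemma eval_poly_var [simp]: "eval_poly \<theta> (poly_var y) = \<theta> y"
  by (simp add: poly_var_def eval_monomial_def)

lemma eval_poly_mult: "eval_poly \<theta> (p * q) = eval_poly \<theta> p * eval_poly \<theta> q"
proof -
  have *: "Poly_Mapping.keys p \<subseteq> UNIV" "Poly_Mapping.keys q \<subseteq> UNIV" by simp_all
  have "eval_poly \<theta> (frag_of m * q) = eval_monomial \<theta> m * eval_poly \<theta> q" for m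
    using *(2) by (induction q rule: frag_induction)
      (simp_all add: mult_single eval_monomial_add right_diff_distrib eval_poly_diff)
  with *(1) show ?thesis
    by (induction p rule: frag_induction) (simp_all add: left_diff_distrib eval_poly_diff)
qed

definition polys_in :: "'y set \<Rightarrow> (('y \<Rightarrow>\<^sub>0 nat) \<Rightarrow>\<^sub>0 int) set"
  where "polys_in Y = {p. \<forall>m \<in> Poly_Mapping.keys p. Poly_Mapping.keys m \<subseteq> Y}"

lemma is_subring_eval_poly: "is_subring (eval_poly \<theta> ` polys_in Y)"
  unfolding is_subring_def
proof (intro conjI ballI)
  have "1 \<in> polys_in Y" by (simp add: polys_in_def)
  then show "1 \<in> eval_poly \<theta> ` polys_in Y" by (intro image_eqI[of _ _ 1]) simp_all
  fix x y assume "x \<in> eval_poly \<theta> ` polys_in Y" "y \<in> eval_poly \<theta> ` polys_in Y"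
  then obtain p q where pq: "p \<in> polys_in Y" "q \<in> polys_in Y" "x = eval_poly \<theta> p" "y = eval_poly \<theta> q"
    by blast
  have "p - q \<in> polys_in Y" using pq(1,2) keys_diff[of p q] by (auto simp: polys_in_def)
  then show "x - y \<in> eval_poly \<theta> ` polys_in Y" by (auto simp: pq(3,4) simp flip: eval_poly_diff)
  have "p * q \<in> polys_in Y"
    using pq(1,2) keys_mult[of p q] by (fastforce simp: polys_in_def dest!: subsetD[OF keys_add])
  then show "x * y \<in> eval_poly \<theta> ` polys_in Y" by (auto simp: pq(3,4) simp flip: eval_poly_mult)
qed

lemma poly_var_in: "y \<in> Y \<Longrightarrow> poly_var y \<in> polys_in Y"
  by (simp add: polys_in_def poly_var_def)

lemma coeff_eval_poly: "coeff (eval_poly \<theta> p) u =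
    (\<Sum>m\<in>Poly_Mapping.keys p. Poly_Mapping.lookup p m * coeff (eval_monomial \<theta> m) u)"
  by (simp add: eval_poly_def lin_ext_def)

text \<open>
  A monomial in the variables \<open>Y\<close> is a multiset of Lyndon words by way of \<open>l\<close>; concatenating it in
  nonincreasing order maps the monomials of degree at most \<open>N\<close> injectively to words of degree at most \<open>N\<close>.
  Surjectivity persists in these degrees, because monomials of larger degree evaluate to
  elements without words of degree at most \<open>N\<close>.
\<close>

lemma eval_poly_injective:
  fixes \<theta> :: "'y \<Rightarrow> 'x::{finite,linorder} free_semigroup qsh"
    and l :: "'y \<Rightarrow> 'x free_semigroup list"
  assumes surj: "\<And>f. f \<in> eval_poly \<theta> ` polys_in Y"
    and hom: "\<And>y. y \<in> Y \<Longrightarrow> homog (\<theta> y) (word_deg (l y))"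
    and l: "inj_on l Y" "\<And>y. y \<in> Y \<Longrightarrow> lyndon (l y)"
    and p: "p \<in> polys_in Y" "eval_poly \<theta> p = 0"
  shows "p = 0"
proof -
  define md where "md = (\<lambda>m. \<Sum>y\<in>Poly_Mapping.keys m. Poly_Mapping.lookup m y * word_deg (l y))"
  define factors where "factors = (\<lambda>m. \<Sum>y\<in>Poly_Mapping.keys m. replicate_mset (Poly_Mapping.lookup m y) (l y))"
  have count_factors: "count (factors m) (l y) = Poly_Mapping.lookup m y"
    if "Poly_Mapping.keys m \<subseteq> Y" "y \<in> Y" for m y
  proof -
    have "count (factors m) (l y) = (\<Sum>z\<in>Poly_Mapping.keys m. if z = y then Poly_Mapping.lookup m z else 0)"
      unfolding factors_def count_sum
      using that l(1) by (intro sum.cong) (auto simp: inj_on_def)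
    then show ?thesis by (auto simp: sum.delta in_keys_iff)
  qed
  have inj_factors: "m = m'" if "Poly_Mapping.keys m \<subseteq> Y" "Poly_Mapping.keys m' \<subseteq> Y" "factors m = factors m'" for m m'
  proof (rule poly_mapping_eqI)
    fix y
    show "Poly_Mapping.lookup m y = Poly_Mapping.lookup m' y"
      using that count_factors by (cases "y \<in> Y") (metis, metis in_keys_iff subsetD)
  qed
  have lyn_factors: "all_lyndon (factors m)" if "Poly_Mapping.keys m \<subseteq> Y" for m
    using that l(2) by (auto simp: all_lyndon_def factors_def set_mset_sum split: if_splits)
  have deg_factors: "word_deg (decr_concat (factors m)) = md m" for m
  proof -
    have "(\<Sum>v\<in>#(\<Sum>y\<in>S. replicate_mset (k y) (l y)). word_deg v) = (\<Sum>y\<in>S. k y * word_deg (l y))"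
      if "finite S" for S k
      using that by induction simp_all
    then show ?thesis by (simp add: word_deg_decr_concat factors_def md_def)
  qed
  have hom_mono: "homog (eval_monomial \<theta> m) (md m)" if "Poly_Mapping.keys m \<subseteq> Y" for m
    unfolding eval_monomial_def md_def using that hom by (intro homog_prod homog_power) auto
  define N where "N = Max (insert 0 (md ` Poly_Mapping.keys p))"
  define X where "X = {m. Poly_Mapping.keys m \<subseteq> Y \<and> md m \<le> N}"
  define W where "W = {w :: 'x free_semigroup list. word_deg w \<le> N}"
  have finW: "finite W" unfolding W_def by (rule finite_words)
  have inj: "inj_on (\<lambda>m. decr_concat (factors m)) X"
    by (intro inj_onI inj_factors Lyndon_factorization_unique lyn_factors) (auto simp: X_def)
  moreover have img: "(\<lambda>m. decr_concat (factors m)) ` X \<subseteq> W"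
    by (auto simp: X_def W_def deg_factors)
  ultimately have finX: "finite X" and card: "card X \<le> card W"
    using finW by (auto intro: inj_on_finite card_inj_on_le)
  show ?thesis
  proof (rule surjective_imp_injective[OF finX finW card])
    show "coeffs (eval_poly \<theta> (p + q)) = coeffs (eval_poly \<theta> p) + coeffs (eval_poly \<theta> q)" for p q
      by (simp add: eval_poly_add plus_qsh.rep_eq)
    show "Poly_Mapping.keys p \<subseteq> X"
    proof
      fix m assume m: "m \<in> Poly_Mapping.keys p"
      then have "md m \<le> N" unfolding N_def by (intro Max_ge) auto
      with m p(1) show "m \<in> X" by (auto simp: X_def polys_in_def)
    qed
    show "coeffs (eval_poly \<theta> p) = 0" using p(2) by (simp add: zero_qsh.rep_eq)
    fix q :: "'x free_semigroup list \<Rightarrow>\<^sub>0 int" assume q: "Poly_Mapping.keys q \<subseteq> W"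
    \<comment> \<open>A preimage of \<open>q\<close> stays a preimage when its monomials of degree greater than \<open>N\<close> are dropped.\<close>
    obtain r where r: "r \<in> polys_in Y" "eval_poly \<theta> r = Qsh q" using surj[of "Qsh q"] by auto
    have "Poly_Mapping.keys r \<subseteq> X \<union> {m. Poly_Mapping.keys m \<subseteq> Y \<and> md m > N}"
      using r(1) by (auto simp: polys_in_def X_def)
    then obtain s t where st: "Poly_Mapping.keys s \<subseteq> X"
        "Poly_Mapping.keys t \<subseteq> {m. Poly_Mapping.keys m \<subseteq> Y \<and> md m > N}" "s + t = r"
      by (rule frag_split)
    have "eval_poly \<theta> s = Qsh q"
    proof (rule qsh_eqI)
      fix u
      have cq: "coeff (Qsh q) u = Poly_Mapping.lookup q u" by (simp add: coeff_def Qsh_inverse)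
      show "coeff (eval_poly \<theta> s) u = coeff (Qsh q) u"
      proof (cases "word_deg u \<le> N")
        case True
        have "coeff (eval_monomial \<theta> m) u = 0" if "m \<in> Poly_Mapping.keys t" for m
          using that st(2) hom_mono[of m] True by (fastforce simp: homog_def)
        then have "coeff (eval_poly \<theta> t) u = 0" by (simp add: coeff_eval_poly)
        then show ?thesis using r(2) st(3) by (metis coeff_simps(2) eval_poly_add add.right_neutral)
      next
        case False
        have "coeff (eval_monomial \<theta> m) u = 0" if "m \<in> Poly_Mapping.keys s" for m
          using that st(1) hom_mono[of m] False by (fastforce simp: homog_def X_def)
        then have "coeff (eval_poly \<theta> s) u = 0" by (simp add: coeff_eval_poly)
        moreover have "Poly_Mapping.lookup q u = 0" using q False by (auto simp: W_def in_keys_iff)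
        ultimately show ?thesis by (simp add: cq)
      qed
    qed
    then show "\<exists>p. Poly_Mapping.keys p \<subseteq> X \<and> coeffs (eval_poly \<theta> p) = q"
      using st(1) by (intro exI[of _ s]) (simp add: Qsh_inverse)
  qed
qed

section \<open>Polynomial generators\<close>

text \<open>
  Both signs of \<open>\<lambda>\<close> are covered by an isomorphism \<open>\<iota>\<close> from the ring for \<open>\<lambda> = 1\<close> that preserves supports and
  hence degrees. The variable of the polynomial algebra that belongs to \<open>y\<close> is evaluated at the preimage of \<open>y\<close>
  under \<open>\<iota>\<close>.
\<close>

lemma polynomial_generators:
  fixes \<iota> :: "'x::{finite,linorder} free_semigroup qsh \<Rightarrow> ('x free_semigroup list \<Rightarrow>\<^sub>0 int)"
  assumes bij: "bij \<iota>"
    and add: "\<And>f g. \<iota> (f + g) = \<iota> f + \<iota> g" and one: "\<iota> 1 = frag_of []"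
    and mult: "\<And>f g. \<iota> (f * g) = mshuffle lam (\<iota> f) (\<iota> g)"
    and keys: "\<And>f. Poly_Mapping.keys (\<iota> f) = Poly_Mapping.keys (coeffs f)"
  shows "\<exists>Y :: nat \<Rightarrow> ('x free_semigroup list \<Rightarrow>\<^sub>0 int) set.
    disjoint_family_on Y {1..} \<and>
    (\<forall>n\<ge>1. Y n \<subseteq> homogeneous n \<and> Y n \<approx> (Lyn n :: 'x free_semigroup list set)) \<and>
    is_polynomial_algebra_on (MS lam) (\<Union>n\<in>{1..}. Y n)"
proof -
  define I where "I = (\<lambda>n. {(v, j) \<in> generator_index. j * word_deg v = n} :: ('x free_semigroup list \<times> nat) set)"
  define gen where "gen = (\<lambda>(v :: 'x free_semigroup list, j). \<iota> (esym v j))"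
  define Y where "Y = (\<lambda>n. gen ` I n)"
  define U where "U = (\<Union>n\<in>{1..}. Y n)"
  have inj: "inj_on gen generator_index"
    using inj_on_esym bij unfolding gen_def by (fastforce simp: inj_on_def bij_def)
  have U: "U = gen ` generator_index"
  proof -
    have "j * word_deg v \<ge> 1" if "(v, j) \<in> generator_index" for v :: "'x free_semigroup list" and j
      using that length_le_word_deg[of v] by (cases v) (auto simp: generator_index_def dest: lyndon_nonempty)
    then show ?thesis by (force simp: U_def Y_def I_def)
  qed
  define idx where "idx = the_inv_into generator_index gen"
  have idx: "idx (gen g) = g" if "g \<in> generator_index" for g
    unfolding idx_def using inj that by (rule the_inv_into_f_f)
  define l where "l = (\<lambda>y. (\<lambda>(v, j). word_power j v) (idx y))"
  have inv: "inv_into UNIV \<iota> (\<iota> f) = f" "\<iota> (inv_into UNIV \<iota> y) = y" for f y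
    using bij by (simp_all add: bij_is_inj bij_is_surj surj_f_inv_f)
  let ?\<theta> = "inv_into UNIV \<iota>"
  have surj: "f \<in> eval_poly ?\<theta> ` polys_in U" for f
  proof (rule esym_generate[OF is_subring_eval_poly])
    fix v :: "'x free_semigroup list" and j assume "(v, j) \<in> generator_index"
    then have "\<iota> (esym v j) \<in> U" unfolding U by (force simp: gen_def)
    then show "esym v j \<in> eval_poly ?\<theta> ` polys_in U"
      by (intro image_eqI[of _ _ "poly_var (\<iota> (esym v j))"] poly_var_in) (simp_all add: inv)
  qed
  have kernel: "p = 0" if "p \<in> polys_in U" "eval_poly ?\<theta> p = 0" for p
  proof (rule eval_poly_injective[OF surj _ _ _ that])
    show "inj_on l U"
      using inj_on_word_power by (auto simp: U l_def idx inj_on_def)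
    show "lyndon (l y)" if "y \<in> U" for y
      using that by (auto simp: U l_def idx generator_index_def lyndon_word_power_iff)
    show "homog (?\<theta> y) (word_deg (l y))" if "y \<in> U" for y
      using that by (auto simp: U l_def idx generator_index_def word_deg_word_power)
        (simp add: gen_def inv homog_esym)
  qed
  have carrier: "carrier (poly_algebra U) = polys_in U"
    by (simp add: poly_algebra_def polys_in_def)
  have "is_polynomial_algebra_on (MS lam) U"
    unfolding is_polynomial_algebra_on_def
  proof (intro conjI bexI[of _ "\<lambda>p. \<iota> (eval_poly ?\<theta> p)"])
    show "U \<subseteq> carrier (MS lam)" by (simp add: MS_def)
    show "\<forall>y\<in>U. \<iota> (eval_poly ?\<theta> (poly_var y)) = y" by (simp add: inv)
    have "inj_on (\<lambda>p. \<iota> (eval_poly ?\<theta> p)) (polys_in U)"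
    proof (rule inj_onI)
      fix p q assume pq: "p \<in> polys_in U" "q \<in> polys_in U" "\<iota> (eval_poly ?\<theta> p) = \<iota> (eval_poly ?\<theta> q)"
      have "p - q \<in> polys_in U" using pq(1,2) keys_diff[of p q] by (auto simp: polys_in_def)
      moreover have "eval_poly ?\<theta> (p - q) = 0" using pq(3) by (metis inv(1) eval_poly_diff diff_self)
      ultimately have "p - q = 0" by (rule kernel)
      then show "p = q" by simp
    qed
    moreover have "(\<lambda>p. \<iota> (eval_poly ?\<theta> p)) ` polys_in U = UNIV"
    proof (intro subset_antisym subsetI UNIV_I)
      fix y
      from surj[of "?\<theta> y"] obtain p where "p \<in> polys_in U" "eval_poly ?\<theta> p = ?\<theta> y" by auto
      then show "y \<in> (\<lambda>p. \<iota> (eval_poly ?\<theta> p)) ` polys_in U"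
        by (intro image_eqI[of _ _ p]) (simp_all add: inv)
    qed
    ultimately have "bij_betw (\<lambda>p. \<iota> (eval_poly ?\<theta> p)) (carrier (poly_algebra U)) (carrier (MS lam))"
      by (simp add: bij_betw_def carrier MS_def)
    then show "(\<lambda>p. \<iota> (eval_poly ?\<theta> p)) \<in> ring_iso (poly_algebra U) (MS lam)"
      by (simp add: ring_iso_def ring_hom_def poly_algebra_def MS_def eval_poly_mult eval_poly_add add mult one)
  qed
  moreover have "disjoint_family_on Y {1..}"
  proof -
    have "I m \<inter> I n = {}" if "m \<noteq> n" for m n using that by (auto simp: I_def)
    moreover have "I n \<subseteq> generator_index" for n by (auto simp: I_def)
    ultimately show ?thesis
      using inj unfolding disjoint_family_on_def Y_def by (metis image_empty inj_on_image_Int)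
  qed
  moreover have "Y n \<subseteq> homogeneous n" for n
    using homog_esym by (fastforce simp: Y_def I_def gen_def homogeneous_def keys homog_def coeff_nonzero_iff)
  moreover have "Y n \<approx> (Lyn n :: 'x free_semigroup list set)" for n
  proof -
    have "inj_on gen (I n)" by (rule inj_on_subset[OF inj]) (auto simp: I_def)
    then have "I n \<approx> Y n" unfolding Y_def by (metis eqpoll_def bij_betw_imageI)
    moreover have "I n \<approx> (Lyn n :: 'x free_semigroup list set)"
      unfolding I_def eqpoll_def using bij_betw_generator_index_Lyn by blast
    ultimately show ?thesis by (metis eqpoll_sym eqpoll_trans)
  qed
  ultimately show ?thesis unfolding U_def by (intro exI[of _ Y]) simp
qed

section \<open>Changing the sign of the weight\<close>

definition sign_twist :: "('s list \<Rightarrow>\<^sub>0 int) \<Rightarrow> ('s list \<Rightarrow>\<^sub>0 int)"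
  where "sign_twist = frag_extend (\<lambda>w. frag_cmul ((-1) ^ length w) (frag_of w))"

lemma sign_twist_frag_of [simp]: "sign_twist (frag_of w) = frag_cmul ((-1) ^ length w) (frag_of w)"
  and sign_twist_zero [simp]: "sign_twist 0 = 0"
  and sign_twist_add: "sign_twist (f + g) = sign_twist f + sign_twist g"
  and sign_twist_diff: "sign_twist (f - g) = sign_twist f - sign_twist g"
  by (simp_all add: sign_twist_def frag_extend_add frag_extend_diff)

lemma lookup_sign_twist: "Poly_Mapping.lookup (sign_twist f) w = (-1) ^ length w * Poly_Mapping.lookup f w"
proof -
  have "Poly_Mapping.keys f \<subseteq> UNIV" by simp
  then show ?thesis
    by (induction f rule: frag_induction) (auto simp: sign_twist_diff lookup_minus right_diff_distrib)
qed

lemma sign_twist_sign_twist: "sign_twist (sign_twist f) = f"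
  by (rule poly_mapping_eqI) (simp add: lookup_sign_twist flip: mult.assoc power_mult_distrib)

lemma keys_sign_twist: "Poly_Mapping.keys (sign_twist f) = Poly_Mapping.keys f"
  by (auto simp: in_keys_iff lookup_sign_twist)

text \<open>
  The sign comes from the additional letter.
\<close>

lemma sign_twist_prepend: "sign_twist (prepend a f) = - prepend a (sign_twist f)"
  by (rule poly_mapping_eqI) (auto simp: lookup_sign_twist lookup_prepend split: list.splits)

lemma sign_twist_mshuffle_words:
  "sign_twist (mshuffle_words lam u v)
    = frag_cmul ((-1) ^ (length u + length v)) (mshuffle_words (- lam) u v)"
proof (induction lam u v rule: mshuffle_words.induct)
  case (3 lam a u b v)
  have cmul: "sign_twist (frag_cmul c f) = frag_cmul c (sign_twist f)" for c and f :: "'a list \<Rightarrow>\<^sub>0 int"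
    by (simp add: sign_twist_def frag_extend_cmul)
  show ?case
    by (rule poly_mapping_eqI)
      (simp add: 3 sign_twist_add cmul sign_twist_prepend prepend_cmul lookup_add algebra_simps)
qed simp_all

lemma sign_twist_mshuffle: "sign_twist (mshuffle lam f g) = mshuffle (- lam) (sign_twist f) (sign_twist g)"
proof (induction f g rule: mshuffle_induct)
  case (1 u v)
  show ?case
    by (simp add: sign_twist_mshuffle_words mshuffle_cmul_left mshuffle_cmul_right power_add mult.commute)
qed (simp_all add: mshuffle_diff_left mshuffle_diff_right sign_twist_diff)

theorem theorem5p3:
  fixes lam :: int
  assumes "lam = 1 \<or> lam = -1"
  shows "\<exists>Y :: nat \<Rightarrow> ('x::{finite,linorder} free_semigroup list \<Rightarrow>\<^sub>0 int) set.
    disjoint_family_on Y {1..} \<and>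
    (\<forall>n\<ge>1. Y n \<subseteq> homogeneous n \<and> Y n \<approx> (Lyn n :: 'x free_semigroup list set)) \<and>
    is_polynomial_algebra_on (MS lam) (\<Union>n\<in>{1..}. Y n)"
  using assms
proof
  have bij: "bij coeffs" by (metis bijI' coeffs_inject coeffs_cases UNIV_I)
  {
    assume "lam = 1"
    then show ?thesis
      by (intro polynomial_generators[where \<iota> = coeffs])
        (simp_all add: bij plus_qsh.rep_eq one_qsh.rep_eq times_qsh.rep_eq)
  next
    assume "lam = -1"
    have "bij sign_twist" by (rule o_bij[of sign_twist]) (simp_all add: fun_eq_iff sign_twist_sign_twist)
    with bij have "bij (sign_twist \<circ> coeffs)" by (intro bij_comp)
    with \<open>lam = -1\<close> show ?thesis
      by (intro polynomial_generators[where \<iota> = "sign_twist \<circ> coeffs"])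
        (simp_all add: plus_qsh.rep_eq one_qsh.rep_eq times_qsh.rep_eq sign_twist_add
          sign_twist_mshuffle keys_sign_twist)
  }
qed

end
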